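(* Let $k$ be a field of characteristic $p>0$ and let $r,m\ge1$ be integers. Then the following assertions hold. (1) Let $N=(N_1,\dots,N_r)\in\mathcal{N}_{m+2,r}$ belong to one of the sets $$(\daleth_{m+2}^\flat)^{\oplus r},\qquad {}^{\ell}\mathfrak{h}^{r_1}_{r_2}(S)^{\oplus r}\quad((\ell,r_1,r_2)\in\Omega_m,\ S\in GL\mathrm{ss}(r_1,k)).$$ Then the map $\varrho:(\mathbb{Z}/p\mathbb{Z})^r\to GL(m+2,k)$ defined by $\varrho([i_1],\dots,[i_r]):=(I_{m+2}+N_1)^{i_1}\cdots(I_{m+2}+N_r)^{i_r}$ is a group homomorphism, and $\varrho((\mathbb{Z}/p\mathbb{Z})^r)\subset\mathfrak{H}(m+2,k)$. (2) Let $\varrho:(\mathbb{Z}/p\mathbb{Z})^r\to GL(m+2,k)$ be a (modular) representation satisfying $\varrho((\mathbb{Z}/p\mathbb{Z})^r)\subset\mathfrak{H}(m+2,k)$, and let $N:=(\varrho(e_1)-I_{m+2},\dots,\varrho(e_r)-I_{m+2})\in\mathcal{N}_{m+2,r}$. Then there exists $N'\in\mathcal{N}_{m+2,r}$ such that $N'$ is equivalent to $N$ and $N'$ belongs to one of the sets $$(\daleth_{m+2}^\flat)^{\oplus r},\qquad {}^{\ell}\mathfrak{h}^{r_1}_{r_2}(S)^{\oplus r}\quad((\ell,r_1,r_2)\in\Omega_m,\ S\in GL\mathrm{ss}(r_1,k)).$$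
   Context: $e_1,\dots,e_r$ are the standard generators of $(\mathbb{Z}/p\mathbb{Z})^r$ ($e_i$ has $i$-th entry $[1]$ and other entries $[0]$). $\mathcal{N}_{n,r}$ is the set of $r$-tuples $(N_1,\dots,N_r)$ of matrices in $\mathrm{Mat}(n,k)$ with $N_i^p=O$ for all $i$ and $N_jN_\ell=N_\ell N_j$ for all $j,\ell$. Two $r$-tuples $(N_i)$, $(N_i')$ are equivalent if there is $P\in GL(n,k)$ with $P^{-1}N_iP=N_i'$ for all $i$. For a subset $\mathfrak{g}\subset\mathrm{Mat}(n,k)$, $\mathfrak{g}^{\oplus r}$ denotes the set of $r$-tuples of elements of $\mathfrak{g}$. For $a_1,\dots,a_{2m+1}\in k$, $\eta(a_1,\dots,a_{2m+1})\in\mathrm{Mat}(m+2,k)$ is the upper triangular matrix with all diagonal entries $1$, first row $(1,a_1,\dots,a_m,a_{2m+1})$, last column ${}^t(a_{2m+1},a_{m+1},\dots,a_{2m},1)$, and all other off-diagonal entries $0$. $\mathfrak{H}(m+2,k)$ (the Heisenberg group) is the set of all such matrices. $\daleth_{m+2}^\flat$ is the set of all matrices $\eta(a_1,\dots,a_{2m+1})-I_{m+2}$ with $a_1,\dots,a_{2m+1}\in k$ for which there is an integer $1\le i\le m+1$ such that $a_j=0$ whenever $j\notin\{i,i+1,\dots,m+i-1\}\cup\{2m+1\}$. $\Omega_m:=\{(\ell,r_1,r_2)\in\mathbb{Z}^3\mid 1\le \ell\le m,\ 1\le r_1\le \ell,\ 0\le r_2\le m-\ell\}$. $GL\mathrm{ss}(n,k)$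 is the set of symmetric matrices in $GL(n,k)$ if $p\ge3$, and the set of symmetric matrices in $GL(n,k)$ with all diagonal entries zero if $p=2$. For $(\ell,r_1,r_2)\in\Omega_m$ and $S\in GL\mathrm{ss}(r_1,k)$, ${}^{\ell}\mathfrak{h}^{r_1}_{r_2}(S)$ is the set of all matrices $\eta(a_1,\dots,a_{2m+1})-I_{m+2}$ with $a_1,\dots,a_{2m+1}\in k$ such that $(a_{m+1},\dots,a_{m+r_1})=(a_1,\dots,a_{r_1})S$ and $a_i=0$ for all $i$ with $\ell+1\le i\le m$, or $m+r_1+1\le i\le m+\ell$, or $m+\ell+r_2+1\le i\le 2m$. *)

theory Defs
  imports "Jordan_Normal_Form.Matrix" "HOL-Algebra.Product_Groups"
begin

definition GL :: "nat \<Rightarrow> ('k::field) mat monoid" where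
  "GL n = units_of (ring_mat TYPE('k) n ())"

text \<open>Tuples \<open>(x\<^sub>1, \<dots>, x\<^sub>r)\<close> are functions on the index set \<open>{1..r}\<close>, extended by
  \<open>undefined\<close> outside it. The class of an integer \<open>i\<close> modulo \<open>p\<close> is represented by \<open>i mod p\<close>.\<close>

definition ZpZ_pow :: "nat \<Rightarrow> nat \<Rightarrow> (nat \<Rightarrow> int) monoid" where
  "ZpZ_pow p r = product_group {1..r} (\<lambda>_. integer_mod_group p)"

definition residue_tuple :: "nat \<Rightarrow> nat \<Rightarrow> (nat \<Rightarrow> int) \<Rightarrow> (nat \<Rightarrow> int)" where
  "residue_tuple p r i = (\<lambda>j\<in>{1..r}. i j mod int p)"

definition std_gen :: "nat \<Rightarrow> nat \<Rightarrow> nat \<Rightarrow> (nat \<Rightarrow> int)" where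
  "std_gen p r i = residue_tuple p r (\<lambda>j. if j = i then 1 else 0)"

definition tuples :: "nat \<Rightarrow> 'a set \<Rightarrow> (nat \<Rightarrow> 'a) set" where
  "tuples r A = (\<Pi>\<^sub>E j\<in>{1..r}. A)"

definition commuting_nilpotents :: "nat \<Rightarrow> nat \<Rightarrow> nat \<Rightarrow> (nat \<Rightarrow> ('k::field) mat) set" where
  "commuting_nilpotents p n r =
    {N \<in> tuples r (carrier_mat n n).
       (\<forall>i\<in>{1..r}. N i ^\<^sub>m p = 0\<^sub>m n n) \<and>
       (\<forall>j\<in>{1..r}. \<forall>l\<in>{1..r}. N j * N l = N l * N j)}"

definition equivalent_tuples ::
  "nat \<Rightarrow> nat \<Rightarrow> (nat \<Rightarrow> ('k::field) mat) \<Rightarrow> (nat \<Rightarrow> 'k mat) \<Rightarrow> bool" where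
  "equivalent_tuples n r N N' \<longleftrightarrow>
    (\<exists>P\<in>carrier (GL n). \<forall>i\<in>{1..r}. inv\<^bsub>GL n\<^esub> P * N i * P = N' i)"

text \<open>Matrix entries are indexed from \<open>0\<close>, whereas the parameters \<open>a\<^sub>1, \<dots>, a\<^bsub>2m+1\<^esub>\<close> are
  indexed from \<open>1\<close>; the other values of \<open>a\<close> are irrelevant.\<close>

definition eta :: "nat \<Rightarrow> (nat \<Rightarrow> 'k::field) \<Rightarrow> 'k mat" where
  "eta m a = mat (m + 2) (m + 2) (\<lambda>(i, j).
     if i = j then 1
     else if i = 0 \<and> j = m + 1 then a (2 * m + 1)
     else if i = 0 then a j
     else if j = m + 1 then a (m + i)
     else 0)"

definition Heisenberg :: "nat \<Rightarrow> ('k::field) mat set" where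
  "Heisenberg m = range (eta m)"

definition daleth_flat :: "nat \<Rightarrow> ('k::field) mat set" where
  "daleth_flat m =
    {eta m a - 1\<^sub>m (m + 2) | a.
       \<exists>i\<in>{1..m + 1}. \<forall>j\<in>{1..2 * m + 1}. j \<notin> {i..m + i - 1} \<union> {2 * m + 1} \<longrightarrow> a j = 0}"

definition Omega :: "nat \<Rightarrow> (nat \<times> nat \<times> nat) set" where
  "Omega m = {(l, r1, r2). 1 \<le> l \<and> l \<le> m \<and> 1 \<le> r1 \<and> r1 \<le> l \<and> r2 \<le> m - l}"

definition GLss :: "nat \<Rightarrow> nat \<Rightarrow> ('k::field) mat set" where
  "GLss p n =
    {S \<in> carrier (GL n). transpose_mat S = S \<and> (p = 2 \<longrightarrow> (\<forall>i<n. S $$ (i, i) = 0))}"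

definition frak_h :: "nat \<Rightarrow> nat \<Rightarrow> nat \<Rightarrow> nat \<Rightarrow> ('k::field) mat \<Rightarrow> 'k mat set" where
  "frak_h m l r1 r2 S =
    {eta m a - 1\<^sub>m (m + 2) | a.
       mat 1 r1 (\<lambda>(_, j). a (m + (j + 1))) = mat 1 r1 (\<lambda>(_, j). a (j + 1)) * S \<and>
       (\<forall>i. l + 1 \<le> i \<and> i \<le> m \<or>
            m + r1 + 1 \<le> i \<and> i \<le> m + l \<or>
            m + l + r2 + 1 \<le> i \<and> i \<le> 2 * m \<longrightarrow> a i = 0)}"

definition in_listed_set :: "nat \<Rightarrow> nat \<Rightarrow> nat \<Rightarrow> (nat \<Rightarrow> ('k::field) mat) \<Rightarrow> bool" where
  "in_listed_set p m r N \<longleftrightarrow>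
    N \<in> tuples r (daleth_flat m) \<or>
    (\<exists>(l, r1, r2)\<in>Omega m. \<exists>S\<in>GLss p r1. N \<in> tuples r (frak_h m l r1 r2 S))"

text \<open>The ordered product \<open>(I + N\<^sub>1)\<^bsup>i\<^sub>1\<^esup> \<cdots> (I + N\<^sub>r)\<^bsup>i\<^sub>r\<^esup>\<close>, with integer exponents taken in \<open>GL n\<close>.\<close>

definition power_product :: "nat \<Rightarrow> nat \<Rightarrow> (nat \<Rightarrow> ('k::field) mat) \<Rightarrow> (nat \<Rightarrow> int) \<Rightarrow> 'k mat" where
  "power_product n r N i =
    foldr (\<lambda>j A. ((1\<^sub>m n + N j) [^]\<^bsub>GL n\<^esub> i j) * A) [1..<Suc r] (1\<^sub>m n)"

end

theory Submission
  imports Defs "Jordan_Normal_Form.Determinant" "HOL-Library.Function_Algebras"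
begin

text \<open>Write an element of the Heisenberg group as a triple \<open>(\<alpha>, \<beta>, c)\<close> of a row, a column and a corner
  entry. Then \<open>(\<alpha>, \<beta>, c) (\<alpha>', \<beta>', c') = (\<alpha> + \<alpha>', \<beta> + \<beta>', c + c' + \<alpha>\<beta>')\<close>, so everything is governed by
  the form \<open>\<alpha>\<beta>'\<close>: the nilpotent parts commute iff the form is symmetric on the tuple, and their
  \<open>p\<close>-th powers vanish automatically for \<open>p \<ge> 3\<close> and iff \<open>\<alpha>\<beta> = 0\<close> for \<open>p = 2\<close>. This gives (1).

  For (2), conjugate by \<open>diag(1, Q, 1)\<close>, which sends \<open>(\<alpha>, \<beta>, c)\<close> to \<open>(\<alpha>Q, Q\<^sup>-\<^sup>1\<beta>, c)\<close>. Let \<open>W\<close> be the span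
  of the columns \<open>\<beta>\<^sub>j\<close> and \<open>V\<close> the common kernel of the rows \<open>\<alpha>\<^sub>j\<close>, and let the columns of \<open>Q\<close> be a
  basis adapted to both: first a basis of \<open>W\<close> modulo \<open>V \<inter> W\<close>, then a complement of \<open>V + W\<close>, then a
  basis of \<open>V \<inter> W\<close>, then the rest of a basis of \<open>V\<close>. This forces all required zeros. If \<open>W \<subseteq> V\<close> the form
  vanishes and the tuple lies in \<open>daleth_flat\<close>. Otherwise the first \<open>r\<^sub>1\<close> basis vectors are combinations
  \<open>u\<^sub>i = \<Sum>\<^sub>j Y\<^sub>i\<^sub>j \<beta>\<^sub>j\<close>; the Gram matrix \<open>T\<close> of the form on these combinations is symmetric (and
  alternating for \<open>p = 2\<close>), symmetry of the form turns \<open>\<beta>\<close>-coordinates into \<open>\<alpha>\<close>-coordinates via \<open>T\<close>,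
  and \<open>T\<close> is nonsingular because the \<open>u\<^sub>i\<close> are independent modulo \<open>V\<close>. So \<open>S = T\<^sup>-\<^sup>1\<close>.\<close>

section \<open>Matrix algebra of the Heisenberg group\<close>

text \<open>The form \<alpha>\<beta>' of the overview: row of \<open>a\<close> against column of
  \<open>b\<close>. It need not be symmetric, and it does not see the corner.\<close>

definition heis_form :: "nat \<Rightarrow> (nat \<Rightarrow> 'k::field) \<Rightarrow> (nat \<Rightarrow> 'k) \<Rightarrow> 'k" where
  "heis_form m a b = (\<Sum>j=1..m. a j * b (m + j))"

lemma eta_carrier [simp]: "eta m a \<in> carrier_mat (m + 2) (m + 2)"
  by (simp add: eta_def)

lemma dim_eta [simp]: "dim_row (eta m a) = Suc (Suc m)" "dim_col (eta m a) = Suc (Suc m)"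
  by (simp_all add: eta_def)

lemma eta_cong:
  assumes "\<And>i. i \<in> {1..2 * m + 1} \<Longrightarrow> a i = b i"
  shows "eta m a = eta m b"
  unfolding eta_def by (rule cong_mat) (auto intro!: assms)

lemma eta_zero: "eta m (\<lambda>_. 0) = 1\<^sub>m (m + 2)"
  by (rule eq_matI) (auto simp: eta_def)

lemma eta_inj:
  assumes eq: "eta m a = eta m b" and "i \<in> {1..2 * m + 1}"
  shows "a i = b i"
proof -
  consider "i \<in> {1..m}" | "i \<in> {m + 1..2 * m}" | "i = 2 * m + 1"
    using assms by force
  then show ?thesis
  proof cases
    case 1
    then show ?thesis using arg_cong[OF eq, of "\<lambda>A. A $$ (0, i)"] by (simp add: eta_def)
  next
    case 2
    then have "i - m < Suc (Suc m)" "i - m \<noteq> 0" "i - m \<noteq> Suc m" by auto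
    then show ?thesis using 2 arg_cong[OF eq, of "\<lambda>A. A $$ (i - m, m + 1)"]
      by (simp add: eta_def)
  next
    case 3
    then show ?thesis using arg_cong[OF eq, of "\<lambda>A. A $$ (0, m + 1)"] by (simp add: eta_def)
  qed
qed

lemma sum_split_ends:
  fixes f :: "nat \<Rightarrow> 'a::comm_monoid_add"
  shows "sum f {0..<m + 2} = f 0 + (\<Sum>i=1..m. f i) + f (m + 1)"
proof -
  have "{0..<m + 2} = insert 0 (insert (m + 1) {1..m})" by auto
  then show ?thesis by (simp add: ac_simps)
qed

text \<open>Isolating the first and last summand follows the block shape 1, m, 1 shared by all
  matrices below.\<close>

lemma mult_mat_index:
  assumes "A \<in> carrier_mat (m + 2) (m + 2)" "B \<in> carrier_mat (m + 2) (m + 2)" "i < m + 2" "j < m + 2"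
  shows "(A * B) $$ (i, j) =
    A $$ (i, 0) * B $$ (0, j) + (\<Sum>t=1..m. A $$ (i, t) * B $$ (t, j)) + A $$ (i, m + 1) * B $$ (m + 1, j)"
proof -
  have "(A * B) $$ (i, j) = (\<Sum>t\<in>{0..<m + 2}. A $$ (i, t) * B $$ (t, j))"
    using assms by (auto simp: scalar_prod_def)
  then show ?thesis by (simp only: sum_split_ends)
qed

lemma eta_mult:
  "eta m a * eta m b = eta m (\<lambda>i. if i = 2 * m + 1 then a i + b i + heis_form m a b else a i + b i)"
    (is "?A * ?B = ?C")
proof (rule eq_matI)
  fix i j assume "i < dim_row ?C" "j < dim_col ?C"
  then have ij: "i < m + 2" "j < m + 2" by auto
  consider "i = 0" | "i \<in> {1..m}" | "i = m + 1" using ij by force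
  note i_cases = this
  consider "j = 0" | "j \<in> {1..m}" | "j = m + 1" using ij by force
  note j_cases = this
  have *: "(\<Sum>t=1..m. ?A $$ (i, t) * ?B $$ (t, j)) =
    (if i = 0 \<and> j = m + 1 then heis_form m a b else if i = 0 \<and> j \<in> {1..m} then a j
     else if i \<in> {1..m} \<and> j \<in> {1..m} \<and> i = j then 1
     else if i \<in> {1..m} \<and> j = m + 1 then b (m + i) else 0)"
    using i_cases
  proof cases
    case 1
    have "(\<Sum>t=1..m. ?A $$ (i, t) * ?B $$ (t, j)) =
       (\<Sum>t=1..m. if j = m + 1 then a t * b (m + t) else if t = j then a j else 0)"
      using 1 ij by (intro sum.cong) (auto simp: eta_def)
    then show ?thesis using 1 ij j_cases by (auto simp: heis_form_def)
  next
    case 2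
    have "(\<Sum>t=1..m. ?A $$ (i, t) * ?B $$ (t, j)) =
       (\<Sum>t=1..m. if t = i then (if i = j then 1 else if j = m + 1 then b (m + i) else 0) else 0)"
      using 2 ij by (intro sum.cong) (auto simp: eta_def)
    also have "\<dots> = (if i = j then 1 else if j = m + 1 then b (m + i) else 0)"
      using 2 by (subst sum.delta) auto
    finally show ?thesis using 2 ij j_cases by auto
  next
    case 3
    then show ?thesis using ij by (auto intro!: sum.neutral simp: eta_def)
  qed
  note prod = mult_mat_index[OF eta_carrier eta_carrier ij, of a b, unfolded *]
  show "(?A * ?B) $$ (i, j) = ?C $$ (i, j)"
    using i_cases
  proof cases
    case 1
    from j_cases show ?thesis unfolding prod by cases (simp_all add: 1 eta_def)
  next
    case 2
    then have "i \<noteq> 0" "i < Suc m" by auto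
    from j_cases show ?thesis unfolding prod
      by cases (use \<open>i \<noteq> 0\<close> \<open>i < Suc m\<close> in \<open>simp_all add: eta_def\<close>)
  next
    case 3
    from j_cases show ?thesis unfolding prod by cases (simp_all add: 3 eta_def)
  qed
qed (auto simp: eta_def)

text \<open>Without the diagonal, a row part can only meet a column part, so one corner entry
  survives. Commutators and p-th powers of the nilpotent parts are read off from it.\<close>

lemma eta_minus_one_mult:
  "(eta m a - 1\<^sub>m (m + 2)) * (eta m b - 1\<^sub>m (m + 2)) =
    mat (m + 2) (m + 2) (\<lambda>(i, j). if i = 0 \<and> j = m + 1 then heis_form m a b else 0)"
    (is "?A * ?B = ?C")
proof -
  let ?I = "1\<^sub>m (m + 2) :: 'a mat"
  have c: "eta m a \<in> carrier_mat (m + 2) (m + 2)" "eta m b \<in> carrier_mat (m + 2) (m + 2)"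
    "eta m a * eta m b \<in> carrier_mat (m + 2) (m + 2)" "?B \<in> carrier_mat (m + 2) (m + 2)"
    by (auto simp: minus_carrier_mat)
  have "?A * ?B = eta m a * ?B - ?I * ?B"
    using c by (intro minus_mult_distrib_mat) auto
  also have "eta m a * ?B = eta m a * eta m b - eta m a * ?I"
    using c by (intro mult_minus_distrib_mat) auto
  also have "\<dots> = eta m a * eta m b - eta m a" 
    by (simp only: right_mult_one_mat[OF c(1)])
  also have "?I * ?B = ?B" by (rule left_mult_one_mat[OF c(4)])
  also have "eta m a * eta m b - eta m a - ?B = ?C"
    unfolding eta_mult by (rule eq_matI) (auto simp: eta_def)
  finally show ?thesis .
qed

lemma eta_minus_one_commute_iff:
  "(eta m a - 1\<^sub>m (m + 2)) * (eta m b - 1\<^sub>m (m + 2)) = (eta m b - 1\<^sub>m (m + 2)) * (eta m a - 1\<^sub>m (m + 2))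
    \<longleftrightarrow> heis_form m a b = heis_form m b a" (is "?L \<longleftrightarrow> ?R")
proof
  assume ?L
  from arg_cong[OF this, of "\<lambda>A. A $$ (0, m + 1)"] show ?R
    unfolding eta_minus_one_mult by simp
qed (simp only: eta_minus_one_mult)

lemma eta_commute_iff: "eta m a * eta m b = eta m b * eta m a \<longleftrightarrow> heis_form m a b = heis_form m b a"
proof
  assume "eta m a * eta m b = eta m b * eta m a"
  from eta_inj[OF this[unfolded eta_mult], of "2 * m + 1"]
  show "heis_form m a b = heis_form m b a" by simp
next
  assume "heis_form m a b = heis_form m b a"
  then show "eta m a * eta m b = eta m b * eta m a"
    unfolding eta_mult by (intro eta_cong) auto
qed

lemma eta_minus_one_pow_ge_3:
  "(eta m a - 1\<^sub>m (m + 2)) ^\<^sub>m (k + 3) = 0\<^sub>m (m + 2) (m + 2)"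
proof (induction k)
  case 0
  let ?A = "eta m a - 1\<^sub>m (m + 2)"
  have A: "?A \<in> carrier_mat (m + 2) (m + 2)" by (simp add: minus_carrier_mat)
  have "?A ^\<^sub>m 3 = ?A * ?A * ?A" 
    using left_mult_one_mat[OF A] by (simp add: numeral_3_eq_3)
  \<comment> \<open>The square is concentrated in the corner, and the last row of a strictly upper
    triangular matrix is zero.\<close>
  also have "\<dots> = 0\<^sub>m (m + 2) (m + 2)"
    unfolding eta_minus_one_mult
  proof (rule eq_matI)
    fix i j assume "i < dim_row (0\<^sub>m (m + 2) (m + 2) :: 'a mat)" "j < dim_col (0\<^sub>m (m + 2) (m + 2) :: 'a mat)"
    then have ij: "i < m + 2" "j < m + 2" by auto
    show "(mat (m + 2) (m + 2) (\<lambda>(i, j). if i = 0 \<and> j = m + 1 then heis_form m a a else 0) * ?A) $$ (i, j)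
       = 0\<^sub>m (m + 2) (m + 2) $$ (i, j)"
      using ij by (subst mult_mat_index[OF _ A ij]) (auto simp: eta_def intro!: sum.neutral)
  qed auto
  finally show ?case by simp
next
  case (Suc k)
  have "(eta m a - 1\<^sub>m (m + 2)) ^\<^sub>m (Suc k + 3)
     = (eta m a - 1\<^sub>m (m + 2)) ^\<^sub>m (k + 3) * (eta m a - 1\<^sub>m (m + 2))"
    unfolding add_Suc pow_mat.simps(2) ..
  also have "\<dots> = 0\<^sub>m (m + 2) (m + 2)" unfolding Suc.IH
    by (rule left_mult_zero_mat) (simp add: minus_carrier_mat)
  finally show ?case .
qed

lemma eta_minus_one_pow_prime_iff:
  assumes "prime p"
  shows "(eta m a - 1\<^sub>m (m + 2)) ^\<^sub>m p = 0\<^sub>m (m + 2) (m + 2) \<longleftrightarrow> (p = 2 \<longrightarrow> heis_form m a a = 0)"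
proof (cases "p = 2")
  case True
  have A: "eta m a - 1\<^sub>m (m + 2) \<in> carrier_mat (m + 2) (m + 2)" by (simp add: minus_carrier_mat)
  have "(eta m a - 1\<^sub>m (m + 2)) ^\<^sub>m p = (eta m a - 1\<^sub>m (m + 2)) * (eta m a - 1\<^sub>m (m + 2))"
    using left_mult_one_mat[OF A] by (simp add: True numeral_2_eq_2)
  also have "\<dots> = 0\<^sub>m (m + 2) (m + 2) \<longleftrightarrow> heis_form m a a = 0" (is "?L \<longleftrightarrow> ?R")
  proof
    assume ?L
    from arg_cong[OF this, of "\<lambda>A. A $$ (0, m + 1)"] show ?R unfolding eta_minus_one_mult by simp
  next
    assume ?R
    then show ?L unfolding eta_minus_one_mult by (intro eq_matI) auto
  qed
  finally show ?thesis using True by simp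
next
  case False
  then obtain k where "p = k + 3"
    using prime_ge_2_nat[OF assms] le_Suc_ex[of 3 p] by (auto simp: add.commute)
  then show ?thesis using False eta_minus_one_pow_ge_3[of m a k] by simp
qed

text \<open>Both assertions pass through this dictionary between matrix tuples and the form:
  commuting becomes symmetry, and for \<open>p = 2\<close> nilpotency becomes vanishing on the
  diagonal.\<close>

lemma commuting_nilpotents_eta_iff:
  assumes "prime p" and "N \<in> extensional {1..r}"
    and N: "\<And>j. j \<in> {1..r} \<Longrightarrow> N j = eta m (a j) - 1\<^sub>m (m + 2)"
  shows "N \<in> commuting_nilpotents p (m + 2) r \<longleftrightarrow>
    (\<forall>j\<in>{1..r}. \<forall>l\<in>{1..r}. heis_form m (a j) (a l) = heis_form m (a l) (a j)) \<and>
    (p = 2 \<longrightarrow> (\<forall>j\<in>{1..r}. heis_form m (a j) (a j) = 0))"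
proof -
  have "N \<in> tuples r (carrier_mat (m + 2) (m + 2))"
    using assms by (auto simp: tuples_def PiE_def minus_carrier_mat)
  moreover have "N j ^\<^sub>m p = 0\<^sub>m (m + 2) (m + 2) \<longleftrightarrow> (p = 2 \<longrightarrow> heis_form m (a j) (a j) = 0)"
    if "j \<in> {1..r}" for j
    unfolding N[OF that] by (rule eta_minus_one_pow_prime_iff[OF assms(1)])
  moreover have "N j * N l = N l * N j \<longleftrightarrow> heis_form m (a j) (a l) = heis_form m (a l) (a j)"
    if "j \<in> {1..r}" "l \<in> {1..r}" for j l
    unfolding N[OF that(1)] N[OF that(2)] by (rule eta_minus_one_commute_iff)
  ultimately show ?thesis unfolding commuting_nilpotents_def by auto
qed

section \<open>The Heisenberg group inside \<open>GL\<close>, and its powers\<close>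

lemma group_GL: "group (GL n)"
proof -
  interpret ring "ring_mat TYPE('a::field) n ()" by (rule ring_mat)
  show "group (GL n :: 'a mat monoid)" unfolding GL_def by (rule units_group)
qed

lemma mult_GL [simp]: "A \<otimes>\<^bsub>GL n\<^esub> B = A * B"
  by (simp add: GL_def units_of_def ring_mat_simps)

lemma one_GL [simp]: "\<one>\<^bsub>GL n\<^esub> = 1\<^sub>m n"
  by (simp add: GL_def units_of_def ring_mat_simps)

text \<open>For square matrices over a field a one-sided inverse is two-sided.\<close>

lemma GL_I:
  assumes "A \<in> carrier_mat n n" "B \<in> carrier_mat n n" "A * B = 1\<^sub>m n"
  shows "A \<in> carrier (GL n)"
  using assms mat_mult_left_right_inverse[OF assms]
  by (auto simp: GL_def units_of_def Units_def ring_mat_simps)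

lemma (in group) inv_equality_right:
  "x \<in> carrier G \<Longrightarrow> y \<in> carrier G \<Longrightarrow> x \<otimes> y = \<one> \<Longrightarrow> inv x = y"
  by (metis inv_equality inv_inv)

lemma eta_GL: "eta m a \<in> carrier (GL (m + 2))"
  and eta_right_inverse_exists: "\<exists>b. eta m a * eta m b = 1\<^sub>m (m + 2)"
proof -
  \<comment> \<open>The inverse of (\<alpha>, \<beta>, c) is (-\<alpha>, -\<beta>, \<alpha>\<beta> -
    c), because the product contributes \<alpha>(-\<beta>) to the corner.\<close>
  let ?b = "\<lambda>i. if i = 2 * m + 1 then heis_form m a a - a i else - a i"
  have "heis_form m a ?b = - heis_form m a a"
    by (auto simp: heis_form_def simp flip: sum_negf intro!: sum.cong)
  then have "eta m a * eta m ?b = eta m (\<lambda>_. 0)"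
    unfolding eta_mult by (intro eta_cong) auto
  then show ex: "\<exists>b. eta m a * eta m b = 1\<^sub>m (m + 2)" by (auto simp: eta_zero)
  from ex show "eta m a \<in> carrier (GL (m + 2))"
    using GL_I[OF eta_carrier eta_carrier] by blast
qed

lemma subgroup_Heisenberg: "subgroup (Heisenberg m) (GL (m + 2))"
proof -
  interpret group "GL (m + 2) :: 'a::field mat monoid" by (rule group_GL)
  show "subgroup (Heisenberg m :: 'a mat set) (GL (m + 2))"
  proof (rule subgroupI)
    fix A assume "A \<in> (Heisenberg m :: 'a mat set)"
    then obtain a where a: "A = eta m a" by (auto simp: Heisenberg_def)
    obtain b where "eta m a * eta m b = 1\<^sub>m (m + 2)" using eta_right_inverse_exists by blast
    then have "inv\<^bsub>GL (m + 2)\<^esub> (eta m a) = eta m b"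
      by (intro inv_equality_right eta_GL) simp
    then show "inv\<^bsub>GL (m + 2)\<^esub> A \<in> Heisenberg m" using a by (metis Heisenberg_def rangeI)
  qed (auto simp: Heisenberg_def eta_mult simp del: add_2_eq_Suc' intro: eta_GL)
qed

text \<open>With A = \<open>eta m a\<close> - I and A^3 = 0 this is the binomial expansion I + qA +
  (q choose 2)A^2, whose quadratic term sits in the corner.\<close>

lemma eta_pow:
  "eta m a [^]\<^bsub>GL (m + 2)\<^esub> (q::nat) =
    eta m (\<lambda>i. if i = 2 * m + 1 then of_nat q * a i + of_nat (q choose 2) * heis_form m a a else of_nat q * a i)"
proof (induction q)
  case 0
  show ?case unfolding nat_pow_0 one_GL eta_zero[symmetric] by (intro eta_cong) (simp add: binomial_eq_0)
next
  case (Suc q)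
  have "heis_form m (\<lambda>i. if i = 2 * m + 1 then of_nat q * a i + of_nat (q choose 2) * heis_form m a a else of_nat q * a i) a
     = of_nat q * heis_form m a a"
    by (auto simp: heis_form_def sum_distrib_left ac_simps intro!: sum.cong)
  moreover have "Suc q choose 2 = q + (q choose 2)"
    by (simp add: numeral_2_eq_2)
  ultimately show ?case unfolding nat_pow_Suc Suc.IH mult_GL eta_mult
    by (intro eta_cong) (auto simp: algebra_simps)
qed

text \<open>The linear term dies because p = 0 in the field, the quadratic one because p divides
  \<open>p choose 2\<close> for odd p. For p = 2 this binomial is 1 and the hypothesis on the form
  takes over.\<close>

lemma eta_pow_char:
  fixes a :: "nat \<Rightarrow> 'k::field"
  assumes "CHAR('k) = p" "prime p" "p = 2 \<longrightarrow> heis_form m a a = 0"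
  shows "eta m a [^]\<^bsub>GL (m + 2)\<^esub> p = 1\<^sub>m (m + 2)"
proof -
  have p0: "of_nat p = (0::'k)" using assms(1) by (metis of_nat_CHAR)
  have "of_nat (p choose 2) * heis_form m a a = 0"
  proof (cases "p = 2")
    case False
    then have "2 < p" using prime_ge_2_nat[OF assms(2)] by simp
    then have "p dvd (p choose 2)" using assms(2) by (intro dvd_choose_prime) auto
    then show ?thesis using assms(1) by (simp add: of_nat_eq_0_iff_char_dvd)
  qed (use assms in simp)
  then show ?thesis unfolding eta_pow eta_zero[symmetric] using p0 by (intro eta_cong) auto
qed

section \<open>Homomorphisms from elementary abelian groups\<close>

lemma (in group) int_pow_mod_eq:
  assumes "x \<in> carrier G" "x [^] (p::nat) = \<one>" "i mod int p = j mod int p"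
  shows "x [^] (i::int) = x [^] j"
proof -
  have "x [^] i = x [^] (i mod int p)" for i :: int
  proof -
    have "x [^] i = x [^] (int p * (i div int p) + i mod int p)" by simp
    also have "\<dots> = (x [^] int p) [^] (i div int p) \<otimes> x [^] (i mod int p)"
      unfolding int_pow_mult[OF assms(1)] int_pow_pow[OF assms(1)] ..
    also have "x [^] int p = \<one>" using assms(2) by (simp add: int_pow_int)
    finally show ?thesis using assms(1) by simp
  qed
  then show ?thesis using assms(3) by metis
qed

lemma (in group) int_pow_commute:
  assumes x: "x \<in> carrier G" and y: "y \<in> carrier G" and xy: "x \<otimes> y = y \<otimes> x"
  shows "x [^] (i::int) \<otimes> y = y \<otimes> x [^] i"
proof (cases i rule: int_cases2)
  case (nonneg n)
  then show ?thesis using group_commutes_pow[OF xy x y, of n] by (simp add: int_pow_int)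
next
  case (nonpos n)
  have "inv (x [^] n) \<otimes> y = y \<otimes> inv (x [^] n)"
    using group_commutes_pow[OF xy x y, of n] x y
    by (metis inv_closed inv_solve_left inv_solve_right m_assoc m_closed nat_pow_closed)
  then show ?thesis using nonpos x by (simp add: int_pow_neg int_pow_int)
qed

lemma (in group) foldr_int_pow_closed:
  assumes "\<And>j. j \<in> set js \<Longrightarrow> x j \<in> carrier G"
  shows "foldr (\<lambda>j A. x j [^] (i j :: int) \<otimes> A) js \<one> \<in> carrier G"
  using assms by (induction js) auto

lemma (in group) foldr_int_pow_add:
  assumes "\<And>j. j \<in> set js \<Longrightarrow> x j \<in> carrier G"
    and "\<And>j l. j \<in> set js \<Longrightarrow> l \<in> set js \<Longrightarrow> x j \<otimes> x l = x l \<otimes> x j"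
  shows "foldr (\<lambda>j A. x j [^] (a j + b j :: int) \<otimes> A) js \<one> =
    foldr (\<lambda>j A. x j [^] a j \<otimes> A) js \<one> \<otimes> foldr (\<lambda>j A. x j [^] b j \<otimes> A) js \<one>"
  using assms
proof (induction js)
  case (Cons t js)
  let ?F = "\<lambda>a js. foldr (\<lambda>j A. x j [^] (a j :: int) \<otimes> A) js \<one>"
  \<comment> \<open>Commuting with every factor passes to the whole product; below, \<open>y\<close>
    is a power of the new head \<open>x t\<close>.\<close>
  have comm: "?F a ks \<otimes> y = y \<otimes> ?F a ks"
    if "\<And>j. j \<in> set ks \<Longrightarrow> x j \<in> carrier G" "\<And>j. j \<in> set ks \<Longrightarrow> x j \<otimes> y = y \<otimes> x j" "y \<in> carrier G"
    for ks y
    using that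
  proof (induction ks)
    case (Cons k ks)
    have c: "?F a ks \<in> carrier G" "x k [^] a k \<in> carrier G"
      using Cons.prems by (auto intro!: foldr_int_pow_closed)
    have "x k [^] a k \<otimes> ?F a ks \<otimes> y = x k [^] a k \<otimes> (y \<otimes> ?F a ks)"
      using Cons c by (simp add: m_assoc)
    also have "\<dots> = (x k [^] a k \<otimes> y) \<otimes> ?F a ks" using Cons.prems c by (simp add: m_assoc)
    also have "x k [^] a k \<otimes> y = y \<otimes> x k [^] a k"
      using Cons.prems by (intro int_pow_commute) auto
    finally show ?case using Cons.prems c by (simp add: m_assoc)
  qed simp
  have c: "?F a js \<in> carrier G" "?F b js \<in> carrier G" "x t \<in> carrier G"
    using Cons.prems by (auto intro!: foldr_int_pow_closed)
  have ft: "?F a js \<otimes> x t [^] b t = x t [^] b t \<otimes> ?F a js"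
    using Cons.prems by (intro comm int_pow_commute[symmetric]) auto
  have "?F (\<lambda>j. a j + b j) (t # js) = x t [^] a t \<otimes> x t [^] b t \<otimes> (?F a js \<otimes> ?F b js)"
    using Cons c by (simp add: int_pow_mult)
  also have "\<dots> = x t [^] a t \<otimes> (x t [^] b t \<otimes> ?F a js) \<otimes> ?F b js"
    using c by (simp add: m_assoc)
  also have "\<dots> = x t [^] a t \<otimes> (?F a js \<otimes> x t [^] b t) \<otimes> ?F b js" by (simp only: ft)
  finally show ?case using c by (simp add: m_assoc)
qed simp

lemma carrier_ZpZ_pow:
  "p > 0 \<Longrightarrow> carrier (ZpZ_pow p r) = (\<Pi>\<^sub>E j\<in>{1..r}. {0..<int p})"
  by (simp add: ZpZ_pow_def carrier_integer_mod_group)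

lemma mult_ZpZ_pow:
  "x \<otimes>\<^bsub>ZpZ_pow p r\<^esub> y = (\<lambda>j\<in>{1..r}. (x j + y j) mod int p)"
  by (simp add: ZpZ_pow_def)

text \<open>\<open>power_product\<close> is itself the required homomorphism: exponents matter only
  modulo p, so the reduction in \<open>ZpZ_pow\<close> is harmless, and commuting factors can be
  regrouped.\<close>

lemma power_product_hom:
  fixes N :: "nat \<Rightarrow> 'k::field mat"
  assumes "p > 0"
    and X: "\<And>j. j \<in> {1..r} \<Longrightarrow> 1\<^sub>m n + N j \<in> H" and H: "subgroup H (GL n)"
    and comm: "\<And>j l. j \<in> {1..r} \<Longrightarrow> l \<in> {1..r} \<Longrightarrow>
      (1\<^sub>m n + N j) * (1\<^sub>m n + N l) = (1\<^sub>m n + N l) * (1\<^sub>m n + N j)"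
    and pow: "\<And>j. j \<in> {1..r} \<Longrightarrow> (1\<^sub>m n + N j) [^]\<^bsub>GL n\<^esub> p = 1\<^sub>m n"
  shows "power_product n r N \<in> hom (ZpZ_pow p r) (GL n)"
    and "power_product n r N (residue_tuple p r i) = power_product n r N i"
    and "power_product n r N i \<in> H"
proof -
  interpret group "GL n :: 'k mat monoid" by (rule group_GL)
  have X': "1\<^sub>m n + N j \<in> carrier (GL n)" if "j \<in> {1..r}" for j
    using X[OF that] subgroup.subset[OF H] by blast
  have js: "set [1..<Suc r] = {1..r}" by auto
  have def: "power_product n r N i =
    foldr (\<lambda>j A. (1\<^sub>m n + N j) [^]\<^bsub>GL n\<^esub> i j \<otimes>\<^bsub>GL n\<^esub> A) [1..<Suc r] \<one>\<^bsub>GL n\<^esub>" for i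
    by (simp add: power_product_def)
  have cong: "power_product n r N i = power_product n r N i'"
    if "\<And>j. j \<in> {1..r} \<Longrightarrow> i j mod int p = i' j mod int p" for i i'
    unfolding def
  proof (rule foldr_cong[OF refl refl])
    fix j A assume "j \<in> set [1..<Suc r]"
    then have j: "j \<in> {1..r}" by auto
    have "(1\<^sub>m n + N j) [^]\<^bsub>GL n\<^esub> i j = (1\<^sub>m n + N j) [^]\<^bsub>GL n\<^esub> i' j"
      using pow[OF j] by (intro int_pow_mod_eq[OF X'[OF j] _ that[OF j]]) simp
    then show "(1\<^sub>m n + N j) [^]\<^bsub>GL n\<^esub> i j \<otimes>\<^bsub>GL n\<^esub> A = (1\<^sub>m n + N j) [^]\<^bsub>GL n\<^esub> i' j \<otimes>\<^bsub>GL n\<^esub> A" by simp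
  qed
  show "power_product n r N (residue_tuple p r i) = power_product n r N i"
    by (rule cong) (simp add: residue_tuple_def)
  show inH: "power_product n r N i \<in> H" for i
  proof -
    have "foldr (\<lambda>j A. (1\<^sub>m n + N j) [^]\<^bsub>GL n\<^esub> i j \<otimes>\<^bsub>GL n\<^esub> A) js \<one>\<^bsub>GL n\<^esub> \<in> H" if "set js \<subseteq> {1..r}" for js
      using that
      by (induction js)
        (auto intro!: subgroup.m_closed[OF H, unfolded mult_GL] subgroup_int_pow_closed[OF H] X
          intro: subgroup.one_closed[OF H, unfolded one_GL])
    then show ?thesis unfolding def js[symmetric] by blast
  qed
  show "power_product n r N \<in> hom (ZpZ_pow p r) (GL n)"
  proof (rule homI)
    fix x assume "x \<in> carrier (ZpZ_pow p r)"
    show "power_product n r N x \<in> carrier (GL n)" using inH subgroup.subset[OF H] by blast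
  next
    fix x y
    have "power_product n r N (x \<otimes>\<^bsub>ZpZ_pow p r\<^esub> y) = power_product n r N (\<lambda>j. x j + y j)"
      by (rule cong) (simp add: mult_ZpZ_pow)
    also have "\<dots> = power_product n r N x \<otimes>\<^bsub>GL n\<^esub> power_product n r N y"
      unfolding def by (rule foldr_int_pow_add) (use X' comm in auto)
    finally show "power_product n r N (x \<otimes>\<^bsub>ZpZ_pow p r\<^esub> y) =
      power_product n r N x \<otimes>\<^bsub>GL n\<^esub> power_product n r N y" .
  qed
qed

section \<open>Assertion (1), and Heisenberg parameters of a representation\<close>

lemma in_listed_set_eta:
  assumes "in_listed_set p m r N"
  obtains a where "N \<in> extensional {1..r}" "\<And>j. j \<in> {1..r} \<Longrightarrow> N j = eta m (a j) - 1\<^sub>m (m + 2)"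
proof -
  have "N \<in> tuples r (range (\<lambda>a. eta m a - 1\<^sub>m (m + 2)))"
  proof -
    have "daleth_flat m \<subseteq> range (\<lambda>a. eta m a - 1\<^sub>m (m + 2))"
      "frak_h m l r1 r2 S \<subseteq> range (\<lambda>a. eta m a - 1\<^sub>m (m + 2))" for l r1 r2 and S :: "'a mat"
      by (auto simp: daleth_flat_def frak_h_def)
    then show ?thesis using assms unfolding in_listed_set_def tuples_def
      by (elim disjE) (force simp: PiE_iff)+
  qed
  then have "N \<in> extensional {1..r}" "\<forall>j\<in>{1..r}. \<exists>a. N j = eta m a - 1\<^sub>m (m + 2)"
    by (auto simp: tuples_def PiE_iff)
  then show thesis using that by metis
qed

lemma one_plus_eta_minus_one: "1\<^sub>m (m + 2) + (eta m a - 1\<^sub>m (m + 2)) = eta m a"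
  by (rule eq_matI) auto

lemma listed_tuple_hom:
  fixes N :: "nat \<Rightarrow> 'k::field mat"
  assumes "CHAR('k) = p" "prime p"
    and "N \<in> commuting_nilpotents p (m + 2) r" "in_listed_set p m r N"
  shows "\<exists>\<rho> \<in> hom (ZpZ_pow p r) (GL (m + 2)).
    (\<forall>i. \<rho> (residue_tuple p r i) = power_product (m + 2) r N i) \<and>
    \<rho> ` carrier (ZpZ_pow p r) \<subseteq> Heisenberg m"
proof -
  obtain a where ext: "N \<in> extensional {1..r}"
    and N: "\<And>j. j \<in> {1..r} \<Longrightarrow> N j = eta m (a j) - 1\<^sub>m (m + 2)"
    using in_listed_set_eta[OF assms(4)] by blast
  note iff = commuting_nilpotents_eta_iff[OF assms(2) ext N, THEN iffD1, OF _ assms(3)]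
  have X: "1\<^sub>m (m + 2) + N j = eta m (a j)" if "j \<in> {1..r}" for j
    unfolding N[OF that] by (rule one_plus_eta_minus_one)
  have 1: "p > 0" using assms(2) by (rule prime_gt_0_nat)
  have 2: "1\<^sub>m (m + 2) + N j \<in> Heisenberg m" if "j \<in> {1..r}" for j
    unfolding X[OF that] Heisenberg_def by blast
  have 3: "(1\<^sub>m (m + 2) + N j) * (1\<^sub>m (m + 2) + N l) = (1\<^sub>m (m + 2) + N l) * (1\<^sub>m (m + 2) + N j)"
    if "j \<in> {1..r}" "l \<in> {1..r}" for j l
    using iff that unfolding X[OF that(1)] X[OF that(2)] eta_commute_iff by blast
  have 4: "(1\<^sub>m (m + 2) + N j) [^]\<^bsub>GL (m + 2)\<^esub> p = 1\<^sub>m (m + 2)" if "j \<in> {1..r}" for j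
    using iff that unfolding X[OF that] by (intro eta_pow_char assms) blast
  note hom = power_product_hom[OF 1 2 subgroup_Heisenberg 3 4]
  show ?thesis using hom by (intro bexI[OF _ hom(1)]) auto
qed

text \<open>Commuting generators make the form symmetric. For p = 2 the square of a generator is
  neutral, and comparing corners gives 2c + \<alpha>\<beta> = 0, where 2 = 0 in the field.\<close>

lemma representation_eta_params:
  fixes \<rho> :: "(nat \<Rightarrow> int) \<Rightarrow> 'k::field mat"
  assumes "CHAR('k) = p" "prime p"
    and hom: "\<rho> \<in> hom (ZpZ_pow p r) (GL (m + 2))" and H: "\<rho> ` carrier (ZpZ_pow p r) \<subseteq> Heisenberg m"
  obtains a where "\<And>j. j \<in> {1..r} \<Longrightarrow> \<rho> (std_gen p r j) = eta m (a j)"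
    and "\<And>j l. j \<in> {1..r} \<Longrightarrow> l \<in> {1..r} \<Longrightarrow> heis_form m (a j) (a l) = heis_form m (a l) (a j)"
    and "\<And>j. p = 2 \<Longrightarrow> j \<in> {1..r} \<Longrightarrow> heis_form m (a j) (a j) = 0"
proof -
  let ?G = "ZpZ_pow p r"
  have p: "p > 0" using assms(2) by (rule prime_gt_0_nat)
  have e: "std_gen p r j \<in> carrier ?G" for j
    using p by (simp add: carrier_ZpZ_pow std_gen_def residue_tuple_def)
  then have "\<forall>j. \<exists>a. \<rho> (std_gen p r j) = eta m a"
    using H unfolding Heisenberg_def by blast
  then obtain a where a: "\<And>j. \<rho> (std_gen p r j) = eta m (a j)" by metis
  have \<rho>_mult: "\<rho> x * \<rho> y = \<rho> (x \<otimes>\<^bsub>?G\<^esub> y)" if "x \<in> carrier ?G" "y \<in> carrier ?G" for x y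
    using hom_mult[OF hom that] by (simp only: mult_GL)
  show thesis
  proof (rule that)
    fix j l
    have "std_gen p r j \<otimes>\<^bsub>?G\<^esub> std_gen p r l = std_gen p r l \<otimes>\<^bsub>?G\<^esub> std_gen p r j"
      by (simp add: mult_ZpZ_pow add.commute)
    then have "eta m (a j) * eta m (a l) = eta m (a l) * eta m (a j)"
      unfolding a[symmetric] \<rho>_mult[OF e e] by (rule arg_cong)
    then show "heis_form m (a j) (a l) = heis_form m (a l) (a j)" by (simp only: eta_commute_iff)
  next
    fix j assume p2: "p = 2" and "j \<in> {1..r}"
    \<comment> \<open>\<open>z\<close> is the neutral element. Its image is idempotent, which forces
      all its parameters to vanish, the corner last.\<close>
    define z where "z = (\<lambda>j\<in>{1..r}. 0::int)"
    have z: "z \<in> carrier ?G" using p by (simp add: carrier_ZpZ_pow z_def)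
    have z_mult: "z \<otimes>\<^bsub>?G\<^esub> z = z" by (auto simp: mult_ZpZ_pow z_def)
    obtain b where b: "\<rho> z = eta m b" using z H unfolding Heisenberg_def by blast
    have bb: "eta m b * eta m b = eta m b" unfolding b[symmetric] \<rho>_mult[OF z z] z_mult ..
    have b0: "b i = 0" if "i \<in> {1..2 * m}" for i
    proof -
      have "b i + b i = b i + 0" using eta_inj[OF bb[unfolded eta_mult], of i] that by auto
      then show ?thesis by (simp only: add_left_cancel)
    qed
    have "b (2 * m + 1) + heis_form m b b = 0"
      using eta_inj[OF bb[unfolded eta_mult], of "2 * m + 1"] by (simp add: add.assoc)
    moreover have "heis_form m b b = 0" unfolding heis_form_def by (intro sum.neutral) (auto simp: b0)
    ultimately have b1: "b (2 * m + 1) = 0" by simp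
    have "std_gen p r j \<otimes>\<^bsub>?G\<^esub> std_gen p r j = z"
      by (auto simp: mult_ZpZ_pow std_gen_def residue_tuple_def z_def p2 fun_eq_iff)
    then have "eta m (a j) * eta m (a j) = eta m b"
      unfolding a[symmetric] b[symmetric] \<rho>_mult[OF e e] by (rule arg_cong)
    from eta_inj[OF this[unfolded eta_mult], of "2 * m + 1"]
    have "2 * a j (2 * m + 1) + heis_form m (a j) (a j) = 0" using b1 by simp
    moreover have "(2::'k) = 0" using assms(1) p2 by (metis of_nat_CHAR of_nat_numeral)
    ultimately show "heis_form m (a j) (a j) = 0" by simp
  qed (rule a)
qed

section \<open>Conjugation by block diagonal matrices\<close>

text \<open>This is diag(1, Q, 1). As index 0 is the border, the inner block has matrix indices
  1..m, the same as those of \<open>q\<close>.\<close>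

definition block_mat :: "nat \<Rightarrow> (nat \<Rightarrow> nat \<Rightarrow> 'k::field) \<Rightarrow> 'k mat" where
  "block_mat m q = mat (m + 2) (m + 2) (\<lambda>(i, j).
     if i \<in> {1..m} \<and> j \<in> {1..m} then q i j else if i = j then 1 else 0)"

lemma block_mat_carrier [simp]: "block_mat m q \<in> carrier_mat (m + 2) (m + 2)"
  by (simp add: block_mat_def)

lemma dim_block_mat [simp]: "dim_row (block_mat m q) = Suc (Suc m)" "dim_col (block_mat m q) = Suc (Suc m)"
  by (simp_all add: block_mat_def)

text \<open>Parameters after conjugation: \<alpha>Q, Q'\<beta> and the unchanged corner, with Q'
  meant as the inverse of Q.\<close>

definition conj_params :: "nat \<Rightarrow> (nat \<Rightarrow> nat \<Rightarrow> 'k::field) \<Rightarrow> (nat \<Rightarrow> nat \<Rightarrow> 'k) \<Rightarrow> (nat \<Rightarrow> 'k) \<Rightarrow> nat \<Rightarrow> 'k" where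
  "conj_params m q q' a i =
    (if i \<in> {1..m} then \<Sum>s=1..m. a s * q s i
     else if i \<in> {m + 1..2 * m} then \<Sum>s=1..m. q' (i - m) s * a (m + s)
     else a i)"

text \<open>The identity QQ' = I in terms of sums; the product in the other order is recovered for
  block matrices in \<open>equivalent_conj_params\<close>.\<close>

definition right_inverse_on :: "nat \<Rightarrow> (nat \<Rightarrow> nat \<Rightarrow> 'k::field) \<Rightarrow> (nat \<Rightarrow> nat \<Rightarrow> 'k) \<Rightarrow> bool" where
  "right_inverse_on m q q' \<longleftrightarrow>
    (\<forall>i\<in>{1..m}. \<forall>j\<in>{1..m}. (\<Sum>t=1..m. q i t * q' t j) = (if i = j then 1 else 0))"

lemma right_inverse_onD:
  "right_inverse_on m q q' \<Longrightarrow> i \<in> {1..m} \<Longrightarrow> j \<in> {1..m} \<Longrightarrow>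
    (\<Sum>t=1..m. q i t * q' t j) = (if i = j then 1 else 0)"
  unfolding right_inverse_on_def by blast

lemma border_index_cases:
  assumes "i < m + 2"
  obtains "i = 0" | "i \<noteq> 0" "i \<in> {1..m}" "i < Suc m" | "i = m + 1"
  using assms by force

lemma block_mat_inverse:
  assumes q: "right_inverse_on m q q'"
  shows "block_mat m q * block_mat m q' = 1\<^sub>m (m + 2)" (is "?A * ?B = ?C")
proof (rule eq_matI)
  fix i j assume "i < dim_row ?C" "j < dim_col ?C"
  then have ij: "i < m + 2" "j < m + 2" by auto
  note prod = mult_mat_index[OF block_mat_carrier block_mat_carrier ij, of q q']
  show "(?A * ?B) $$ (i, j) = ?C $$ (i, j)"
    using ij(1)
  proof (cases rule: border_index_cases)
    case 1
    from ij(2) show ?thesis unfolding prod by (cases rule: border_index_cases) (simp_all add: 1 block_mat_def)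
  next
    case 2
    from ij(2) show ?thesis unfolding prod
      by (cases rule: border_index_cases) (use 2 in \<open>simp_all add: block_mat_def right_inverse_onD[OF q, simplified]\<close>)
  next
    case 3
    from ij(2) show ?thesis unfolding prod by (cases rule: border_index_cases) (simp_all add: 3 block_mat_def)
  qed
qed auto

text \<open>Writing the conjugation as XP = PX' keeps inverse matrices out of the entrywise
  computation.\<close>

lemma eta_block_mat:
  assumes q: "right_inverse_on m q q'"
  shows "eta m a * block_mat m q = block_mat m q * eta m (conj_params m q q' a)" (is "?A * ?B = ?B * ?C")
proof (rule eq_matI)
  fix i j assume "i < dim_row (?B * ?C)" "j < dim_col (?B * ?C)"
  then have ij: "i < m + 2" "j < m + 2" by auto
  note prod1 = mult_mat_index[OF eta_carrier block_mat_carrier ij, of a q]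
  note prod2 = mult_mat_index[OF block_mat_carrier eta_carrier ij, of q "conj_params m q q' a"]
  \<comment> \<open>The last column: Q(Q'\<beta>) = \<beta>, which is where QQ' = I enters.\<close>
  have last: "(\<Sum>t=1..m. q i t * conj_params m q q' a (m + t)) = a (m + i)" if i: "i \<in> {1..m}"
  proof -
    have "(\<Sum>t=1..m. q i t * conj_params m q q' a (m + t)) = (\<Sum>t=1..m. \<Sum>s=1..m. q i t * q' t s * a (m + s))"
      by (intro sum.cong) (auto simp: conj_params_def sum_distrib_left mult.assoc)
    also have "\<dots> = (\<Sum>s=1..m. (\<Sum>t=1..m. q i t * q' t s) * a (m + s))"
      by (subst sum.swap) (simp add: sum_distrib_right)
    also have "\<dots> = (\<Sum>s=1..m. if i = s then a (m + s) else 0)"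
      by (intro sum.cong) (use i in \<open>auto simp: right_inverse_onD[OF q, simplified]\<close>)
    finally show ?thesis using i by simp
  qed
  have mid: "(\<Sum>t=1..m. (if i = t then 1 else 0) * q t j) = q i j"
    "(\<Sum>t=1..m. q i t * (if t = j then 1 else 0)) = q i j" if "i \<in> {1..m}" "j \<in> {1..m}"
    using that by (simp_all add: if_distrib if_distribR cong: if_cong)
  show "(?A * ?B) $$ (i, j) = (?B * ?C) $$ (i, j)"
    using ij(1)
  proof (cases rule: border_index_cases)
    case 1
    from ij(2) show ?thesis unfolding prod1 prod2
      by (cases rule: border_index_cases) (simp_all add: 1 block_mat_def eta_def conj_params_def)
  next
    case 2
    from ij(2) show ?thesis
    proof (cases rule: border_index_cases)
      case 1
      then show ?thesis unfolding prod1 prod2 using 2 by (simp add: block_mat_def eta_def)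
    next
      case j: 2
      have "(\<Sum>t=1..m. ?A $$ (i, t) * ?B $$ (t, j)) = (\<Sum>t=1..m. (if i = t then 1 else 0) * q t j)"
        "(\<Sum>t=1..m. ?B $$ (i, t) * ?C $$ (t, j)) = (\<Sum>t=1..m. q i t * (if t = j then 1 else 0))"
        using 2 j by (auto intro!: sum.cong simp: block_mat_def eta_def)
      then show ?thesis unfolding prod1 prod2 using 2 j mid by (simp add: block_mat_def eta_def)
    next
      case 3
      then show ?thesis unfolding prod1 prod2 using 2 last by (simp add: block_mat_def eta_def)
    qed
  next
    case 3
    from ij(2) show ?thesis unfolding prod1 prod2
      by (cases rule: border_index_cases) (simp_all add: 3 block_mat_def eta_def)
  qed
qed auto

text \<open>\<alpha>QQ'\<beta>' = \<alpha>\<beta>'. Hence the conjugated tuple inherits the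
  conditions on the form.\<close>

lemma heis_form_conj_params:
  assumes q: "right_inverse_on m q q'"
  shows "heis_form m (conj_params m q q' a) (conj_params m q q' b) = heis_form m a b"
proof -
  have "heis_form m (conj_params m q q' a) (conj_params m q q' b) =
    (\<Sum>t=1..m. (\<Sum>s=1..m. a s * q s t) * (\<Sum>u=1..m. q' t u * b (m + u)))"
    unfolding heis_form_def by (intro sum.cong) (auto simp: conj_params_def)
  also have "\<dots> = (\<Sum>t=1..m. \<Sum>s=1..m. \<Sum>u=1..m. a s * (q s t * q' t u) * b (m + u))"
    by (simp add: sum_product ac_simps)
  also have "\<dots> = (\<Sum>s=1..m. \<Sum>u=1..m. \<Sum>t=1..m. a s * (q s t * q' t u) * b (m + u))"
    by (subst sum.swap, rule sum.cong[OF refl], rule sum.swap)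
  also have "\<dots> = (\<Sum>s=1..m. \<Sum>u=1..m. a s * (\<Sum>t=1..m. q s t * q' t u) * b (m + u))"
    by (simp add: sum_distrib_left sum_distrib_right)
  also have "\<dots> = (\<Sum>s=1..m. \<Sum>u=1..m. if s = u then a s * b (m + u) else 0)"
    by (intro sum.cong) (auto simp: right_inverse_onD[OF q, simplified])
  finally show ?thesis by (simp add: heis_form_def)
qed

lemma equivalent_conj_params:
  assumes q: "right_inverse_on m q q'"
    and N: "\<And>j. j \<in> {1..r} \<Longrightarrow> N j = eta m (a j) - 1\<^sub>m (m + 2)"
    and N': "\<And>j. j \<in> {1..r} \<Longrightarrow> N' j = eta m (conj_params m q q' (a j)) - 1\<^sub>m (m + 2)"
  shows "equivalent_tuples (m + 2) r N N'"
proof -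
  interpret group "GL (m + 2) :: 'a mat monoid" by (rule group_GL)
  let ?P = "block_mat m q" and ?Q = "block_mat m q'" and ?I = "1\<^sub>m (m + 2) :: 'a mat"
  have PQ: "?P * ?Q = ?I" by (rule block_mat_inverse[OF q])
  note c = block_mat_carrier[of m q] block_mat_carrier[of m q']
  have QP: "?Q * ?P = ?I" by (rule mat_mult_left_right_inverse[OF c PQ])
  have P: "?P \<in> carrier (GL (m + 2))" by (rule GL_I[OF c PQ])
  have Q: "?Q \<in> carrier (GL (m + 2))" by (rule GL_I[OF c(2,1) QP])
  have inv: "inv\<^bsub>GL (m + 2)\<^esub> ?P = ?Q"
    by (rule inv_equality_right[OF P Q]) (simp only: mult_GL one_GL PQ)
  have "?Q * N j * ?P = N' j" if "j \<in> {1..r}" for j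
  proof -
    let ?E = "eta m (a j)" and ?E' = "eta m (conj_params m q q' (a j))"
    have cE: "?E \<in> carrier_mat (m + 2) (m + 2)" "?E' \<in> carrier_mat (m + 2) (m + 2)" by (rule eta_carrier)+
    have "?Q * (?E - ?I) * ?P = ?Q * ((?E - ?I) * ?P)"
      using c cE by (intro assoc_mult_mat) (auto simp: minus_carrier_mat)
    also have "(?E - ?I) * ?P = ?E * ?P - ?P"
      using minus_mult_distrib_mat[OF cE(1) one_carrier_mat c(1)] left_mult_one_mat[OF c(1)] by simp
    also have "\<dots> = ?P * ?E' - ?P" by (simp only: eta_block_mat[OF q])
    also have "?Q * \<dots> = ?Q * (?P * ?E') - ?Q * ?P"
      using c cE by (intro mult_minus_distrib_mat) auto
    also have "?Q * (?P * ?E') = ?Q * ?P * ?E'"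
      using c cE by (intro assoc_mult_mat[symmetric])
    also have "\<dots> = ?E'" unfolding QP by (rule left_mult_one_mat[OF cE(2)])
    finally show ?thesis unfolding N[OF that] N'[OF that] QP .
  qed
  then show ?thesis unfolding equivalent_tuples_def using P inv by (intro bexI[of _ ?P]) auto
qed

section \<open>Bases adapted to two subspaces\<close>

lemma (in vector_space) two_subspaces_basis:
  assumes V: "subspace V" "V \<subseteq> span E" and W: "subspace W" "W \<subseteq> span E"
  obtains B C D R where "independent (C \<union> D \<union> B \<union> R)" "span (C \<union> D \<union> B \<union> R) = span E"
    and "C \<inter> D = {}" "(C \<union> D) \<inter> B = {}" "(C \<union> D \<union> B) \<inter> R = {}"
    and "C \<subseteq> W" "B \<subseteq> V \<inter> W" "R \<subseteq> V" "V \<subseteq> span (B \<union> R)" "W \<subseteq> span (C \<union> B)"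
proof -
  have "independent {}" by (rule independent_empty)
  \<comment> \<open>Successive extension gives bases \<open>B\<close>, \<open>B1\<close>,
    \<open>B2\<close>, \<open>B3\<close> of V \<inter> W, V, V + W and the whole span;
    \<open>C\<close>, \<open>D\<close>, \<open>R\<close> are differences in this chain. Taking the
    new vectors of \<open>B2\<close> from W puts \<open>C\<close> inside W.\<close>
  then obtain B where B: "B \<subseteq> V \<inter> W" "independent B" "V \<inter> W \<subseteq> span B"
    by (rule maximal_independent_subset_extend[OF empty_subsetI])
  then obtain B1 where B1: "B \<subseteq> B1" "B1 \<subseteq> V" "independent B1" "V \<subseteq> span B1"
    using maximal_independent_subset_extend[of B V] by blast
  then obtain B2 where B2: "B1 \<subseteq> B2" "B2 \<subseteq> B1 \<union> W" "independent B2" "B1 \<union> W \<subseteq> span B2"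
    using maximal_independent_subset_extend[of B1 "B1 \<union> W"] by blast
  have "B2 \<subseteq> span E" using B2 B1 V W by blast
  then obtain B3 where B3: "B2 \<subseteq> B3" "B3 \<subseteq> span E" "independent B3" "span E \<subseteq> span B3"
    using maximal_independent_subset_extend[OF _ B2(3)] by blast
  let ?C = "B2 - B1" and ?D = "B3 - B2" and ?R = "B1 - B"
  have un: "?C \<union> ?D \<union> B \<union> ?R = B3" using B1 B2 B3 by blast
  show thesis
  proof (rule that)
    show "independent (?C \<union> ?D \<union> B \<union> ?R)" unfolding un by (rule B3)
    show "span (?C \<union> ?D \<union> B \<union> ?R) = span E" unfolding un
      using B3 by (simp add: span_minimal subset_antisym)
    have "B \<union> ?R = B1" using B1 by blast
    then show "V \<subseteq> span (B \<union> ?R)" using B1 by simp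
    show CW: "?C \<subseteq> W" using B2 by blast
    show "W \<subseteq> span (?C \<union> B)"
    proof
      \<comment> \<open>Split w along \<open>C\<close> and \<open>B1\<close>. The \<open>C\<close>
        part lies in W, so the \<open>B1\<close> part lies in V \<inter> W, hence in the span of
        \<open>B\<close>.\<close>
      fix w assume w: "w \<in> W"
      have "w \<in> span (?C \<union> B1)" using w B2 by (simp add: Un_absorb2 subset_iff)
      then obtain x y where xy: "w = x + y" "x \<in> span ?C" "y \<in> span B1" unfolding span_Un by blast
      have "x \<in> W" using xy(2) span_minimal[OF CW W(1)] by blast
      then have "y \<in> W" using subspace_diff[OF W(1) w, of x] xy(1) by simp
      moreover have "y \<in> V" using xy(3) span_minimal[OF B1(2) V(1)] by blast
      ultimately have "y \<in> span B" using B by blast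
      then show "w \<in> span (?C \<union> B)" unfolding span_Un using xy by blast
    qed
  qed (use B B1 B2 B3 in auto)
qed

text \<open>Concatenating lists of the four sets gives each an interval of positions;
  \<open>i - 1\<close> turns indices counted from 1 into list positions.\<close>

lemma enumerate_four_blocks:
  assumes "finite (A \<union> B \<union> C \<union> D)" "A \<inter> B = {}" "(A \<union> B) \<inter> C = {}" "(A \<union> B \<union> C) \<inter> D = {}"
  obtains u where "bij_betw u {1..card (A \<union> B \<union> C \<union> D)} (A \<union> B \<union> C \<union> D)"
    and "\<And>i. i \<in> {1..card A} \<Longrightarrow> u i \<in> A"
    and "\<And>i. i \<in> {card A + 1..card (A \<union> B)} \<Longrightarrow> u i \<in> B"
    and "\<And>i. i \<in> {card (A \<union> B) + 1..card (A \<union> B \<union> C)} \<Longrightarrow> u i \<in> C"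
    and "\<And>i. i \<in> {card (A \<union> B \<union> C) + 1..card (A \<union> B \<union> C \<union> D)} \<Longrightarrow> u i \<in> D"
proof -
  obtain as bs cs ds where
    l: "set as = A" "distinct as" "set bs = B" "distinct bs" "set cs = C" "distinct cs" "set ds = D" "distinct ds"
    using finite_distinct_list assms(1) by (metis finite_Un)
  have len: "card A = length as" "card (A \<union> B) = length (as @ bs)" "card (A \<union> B \<union> C) = length (as @ bs @ cs)"
    "card (A \<union> B \<union> C \<union> D) = length (as @ bs @ cs @ ds)"
    using l assms by (auto simp: distinct_card card_Un_disjoint)
  let ?xs = "as @ bs @ cs @ ds"
  have set: "set ?xs = A \<union> B \<union> C \<union> D" and dist: "distinct ?xs" using l assms by auto
  have "bij_betw (nth ?xs \<circ> (\<lambda>i. i - 1)) {1..length ?xs} (set ?xs)"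
  proof (rule bij_betw_trans)
    show "bij_betw (\<lambda>i::nat. i - 1) {1..length ?xs} {..<length ?xs}"
      by (rule bij_betw_byWitness[where f' = Suc]) auto
    show "bij_betw (nth ?xs) {..<length ?xs} (set ?xs)"
      by (rule bij_betw_nth[OF dist refl refl])
  qed
  then show thesis
    unfolding set len(4)[symmetric]
  proof (rule that)
    fix i
    show "i \<in> {1..card A} \<Longrightarrow> (nth ?xs \<circ> (\<lambda>i. i - 1)) i \<in> A"
      unfolding len by (auto simp: nth_append l(1)[symmetric])
    show "i \<in> {card A + 1..card (A \<union> B)} \<Longrightarrow> (nth ?xs \<circ> (\<lambda>i. i - 1)) i \<in> B"
      unfolding len by (auto simp: nth_append l(3)[symmetric])
    show "i \<in> {card (A \<union> B) + 1..card (A \<union> B \<union> C)} \<Longrightarrow> (nth ?xs \<circ> (\<lambda>i. i - 1)) i \<in> C"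
      unfolding len by (auto simp: nth_append l(5)[symmetric])
    show "i \<in> {card (A \<union> B \<union> C) + 1..card (A \<union> B \<union> C \<union> D)} \<Longrightarrow> (nth ?xs \<circ> (\<lambda>i. i - 1)) i \<in> D"
      unfolding len by (auto simp: nth_append l(7)[symmetric])
  qed
qed

text \<open>Coefficients are set to 0 outside \<open>I\<close> as well, so that supports can later
  be described by unrestricted statements about the index.\<close>

lemma (in vector_space) span_indexed:
  assumes u: "bij_betw u I X" and I: "finite I" and Y: "Y \<subseteq> X" and v: "v \<in> span Y"
  obtains c where "v = (\<Sum>i\<in>I. c i *s u i)" "\<And>i. i \<in> I \<Longrightarrow> u i \<notin> Y \<Longrightarrow> c i = 0" "\<And>i. i \<notin> I \<Longrightarrow> c i = 0"
proof -
  have X: "finite X" using u I bij_betw_finite by blast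
  then have "finite Y" using Y finite_subset by blast
  then obtain d where d: "v = (\<Sum>y\<in>Y. d y *s y)" using v by (auto simp: span_finite)
  let ?c = "\<lambda>i. if i \<in> I \<and> u i \<in> Y then d (u i) else 0"
  have "(\<Sum>i\<in>I. ?c i *s u i) = (\<Sum>i\<in>I. if u i \<in> Y then d (u i) *s u i else 0)"
    by (intro sum.cong) auto
  also have "\<dots> = (\<Sum>x\<in>X. if x \<in> Y then d x *s x else 0)"
    by (rule sum.reindex_bij_betw[OF u])
  also have "\<dots> = v" using X Y d by (simp add: sum.If_cases Int_absorb1)
  finally show thesis by (intro that[of ?c]) auto
qed

text \<open>Vectors of \<open>k\<^sup>m\<close> are functions supported on \<open>{1..m}\<close>.\<close>

definition fun_scale :: "'k::field \<Rightarrow> (nat \<Rightarrow> 'k) \<Rightarrow> nat \<Rightarrow> 'k" where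
  "fun_scale c f = (\<lambda>i. c * f i)"

interpretation fun_vs: vector_space fun_scale
  by unfold_locales (auto simp: fun_scale_def fun_eq_iff algebra_simps)

lemma sum_fun_scale_apply: "(\<Sum>i\<in>I. fun_scale (c i) (u i)) t = (\<Sum>i\<in>I. c i * u i t)"
  by (induction I rule: infinite_finite_induct) (auto simp: fun_scale_def)

definition coord_space :: "nat \<Rightarrow> (nat \<Rightarrow> 'k::field) set" where
  "coord_space m = {v. \<forall>i. i \<notin> {1..m} \<longrightarrow> v i = 0}"

text \<open>A basis as an indexed family: stating independence through coefficients also excludes
  repetitions among the \<open>u i\<close>.\<close>

definition coord_basis :: "nat \<Rightarrow> (nat \<Rightarrow> nat \<Rightarrow> 'k::field) \<Rightarrow> bool" where
  "coord_basis m u \<longleftrightarrow> (\<forall>i\<in>{1..m}. u i \<in> coord_space m) \<and>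
    (\<forall>v\<in>coord_space m. \<exists>c. v = (\<Sum>i=1..m. fun_scale (c i) (u i))) \<and>
    (\<forall>c. (\<Sum>i=1..m. fun_scale (c i) (u i)) = 0 \<longrightarrow> (\<forall>i\<in>{1..m}. c i = 0))"

text \<open>The blocks \<open>C\<close>, \<open>D\<close>, \<open>B\<close>, \<open>R\<close> become
  the intervals 1..r1, r1+1..l, l+1..l+r2, l+r2+1..m. So V has coordinates in the last two and W in
  the first and third.\<close>

lemma adapted_basis:
  fixes V W :: "(nat \<Rightarrow> 'k::field) set"
  assumes V: "fun_vs.subspace V" "V \<subseteq> coord_space m"
    and W: "fun_vs.subspace W" "W \<subseteq> coord_space m"
  obtains u l r1 r2 where "r1 \<le> l" "l + r2 \<le> m"
    and "coord_basis m u"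
    and "u ` {1..r1} \<subseteq> W" "u ` {l + 1..m} \<subseteq> V"
    and "\<forall>v\<in>V. \<exists>c. (\<forall>i. i \<notin> {l + 1..m} \<longrightarrow> c i = 0) \<and> v = (\<Sum>i=1..m. fun_scale (c i) (u i))"
    and "\<forall>v\<in>W. \<exists>c. (\<forall>i. i \<notin> {1..r1} \<union> {l + 1..l + r2} \<longrightarrow> c i = 0) \<and>
      v = (\<Sum>i=1..m. fun_scale (c i) (u i))"
proof -
  define e :: "nat \<Rightarrow> nat \<Rightarrow> 'k" where "e = (\<lambda>i j. if j = i then 1 else 0)"
  let ?E = "e ` {1..m}"
  have inj_e: "inj e"
    by (rule injI) (metis e_def zero_neq_one)
  have e_sum: "(\<Sum>i=1..m. fun_scale (c i) (e i)) t = (if t \<in> {1..m} then c t else 0)" for c t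
    unfolding sum_fun_scale_apply e_def by (simp add: if_distrib cong: if_cong)
  have spanE: "fun_vs.span ?E = coord_space m"
  proof (intro subset_antisym subsetI)
    fix v
    assume "v \<in> fun_vs.span ?E"
    moreover have "bij_betw e {1..m} ?E" using inj_e by (meson inj_on_imp_bij_betw inj_on_subset subset_UNIV)
    ultimately obtain c where "v = (\<Sum>i=1..m. fun_scale (c i) (e i))"
      using fun_vs.span_indexed[of e "{1..m}" ?E ?E v] by auto
    then show "v \<in> coord_space m" using e_sum[of c] by (simp add: coord_space_def)
  next
    fix v :: "nat \<Rightarrow> 'k" assume "v \<in> coord_space m"
    then have "v = (\<Sum>i=1..m. fun_scale (v i) (e i))" using e_sum[of v] by (auto simp: fun_eq_iff coord_space_def)
    moreover have "(\<Sum>i=1..m. fun_scale (v i) (e i)) \<in> fun_vs.span ?E"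
      by (intro fun_vs.span_sum fun_vs.span_scale fun_vs.span_base) auto
    ultimately show "v \<in> fun_vs.span ?E" by simp
  qed
  have indE: "fun_vs.independent ?E"
  proof (rule fun_vs.independent_if_scalars_zero)
    fix f x assume s: "(\<Sum>x\<in>?E. fun_scale (f x) x) = 0" and "x \<in> ?E"
    then obtain i where i: "i \<in> {1..m}" "x = e i" by blast
    have "(\<Sum>x\<in>?E. fun_scale (f x) x) = (\<Sum>i=1..m. fun_scale (f (e i)) (e i))"
      by (subst sum.reindex) (auto intro: inj_on_subset[OF inj_e])
    then have "(\<Sum>i=1..m. fun_scale (f (e i)) (e i)) i = 0" using s by simp
    then show "f x = 0" using i e_sum[of "\<lambda>i. f (e i)" i] by simp
  qed simp
  have cardE: "card ?E = m" using inj_e by (simp add: card_image inj_on_subset[OF inj_e])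
  have VE: "V \<subseteq> fun_vs.span ?E" "W \<subseteq> fun_vs.span ?E" using V(2) W(2) by (simp_all only: spanE)
  obtain B C D R where ind: "fun_vs.independent (C \<union> D \<union> B \<union> R)"
    and span: "fun_vs.span (C \<union> D \<union> B \<union> R) = fun_vs.span ?E"
    and disj: "C \<inter> D = {}" "(C \<union> D) \<inter> B = {}" "(C \<union> D \<union> B) \<inter> R = {}"
    and sub: "C \<subseteq> W" "B \<subseteq> V \<inter> W" "R \<subseteq> V" "V \<subseteq> fun_vs.span (B \<union> R)" "W \<subseteq> fun_vs.span (C \<union> B)"
    by (rule fun_vs.two_subspaces_basis[OF V(1) VE(1) W(1) VE(2)])
  let ?X = "C \<union> D \<union> B \<union> R"
  have fin: "finite ?X"
    using fun_vs.independent_span_bound[of ?E ?X] ind span fun_vs.span_superset[of ?X] by auto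
  \<comment> \<open>\<open>?X\<close> and the standard basis are bases of the same space, so exactly
    m vectors get enumerated.\<close>
  have cardX: "card ?X = m"
    using fun_vs.dim_eq_card[OF span ind] fun_vs.dim_eq_card[OF refl indE] cardE by simp
  obtain u where bij: "bij_betw u {1..m} ?X" and blocks:
    "\<And>i. i \<in> {1..card C} \<Longrightarrow> u i \<in> C"
    "\<And>i. i \<in> {card C + 1..card (C \<union> D)} \<Longrightarrow> u i \<in> D"
    "\<And>i. i \<in> {card (C \<union> D) + 1..card (C \<union> D \<union> B)} \<Longrightarrow> u i \<in> B"
    "\<And>i. i \<in> {card (C \<union> D \<union> B) + 1..m} \<Longrightarrow> u i \<in> R"
    by (rule enumerate_four_blocks[OF fin disj, unfolded cardX]) (rule that; blast)
  define l r1 r2 where "l = card (C \<union> D)" "r1 = card C" "r2 = card B"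
  have card3: "card (C \<union> D \<union> B) = l + r2"
    using disj fin by (simp add: card_Un_disjoint l_r1_r2_def)
  note blocks' = blocks[unfolded card3, folded l_r1_r2_def]
  have cardl: "l = r1 + card D" using disj fin by (simp add: card_Un_disjoint l_r1_r2_def)
  show thesis
  proof (rule that)
    show "r1 \<le> l" using cardl by simp
    show "l + r2 \<le> m" unfolding card3[symmetric] cardX[symmetric] using fin by (intro card_mono) auto
    have *: "u i \<in> coord_space m" if "i \<in> {1..m}" for i
    proof -
      have "u i \<in> ?X" using bij that by (meson bij_betwE)
      then show ?thesis unfolding spanE[symmetric] span[symmetric] by (rule fun_vs.span_base)
    qed
    have **: "\<exists>c. v = (\<Sum>i=1..m. fun_scale (c i) (u i))" if "v \<in> coord_space m" for v
    proof -
      have "v \<in> fun_vs.span ?X" unfolding span spanE by (rule that)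
      then show ?thesis
        by (rule fun_vs.span_indexed[OF bij finite_atLeastAtMost subset_refl]) auto
    qed
    \<comment> \<open>Relabelling coefficients by vectors, through the inverse of \<open>u\<close>,
      reduces this to independence of the set \<open>?X\<close>.\<close>
    have "c i = 0" if s: "(\<Sum>i=1..m. fun_scale (c i) (u i)) = 0" and i: "i \<in> {1..m}" for c i
    proof -
      let ?g = "inv_into {1..m} u"
      have inj: "inj_on u {1..m}" using bij by (rule bij_betw_imp_inj_on)
      have "(\<Sum>x\<in>?X. fun_scale (c (?g x)) x) = (\<Sum>i=1..m. fun_scale (c (?g (u i))) (u i))"
        by (rule sum.reindex_bij_betw[OF bij, symmetric])
      also have "\<dots> = (\<Sum>i=1..m. fun_scale (c i) (u i))"
        by (intro sum.cong refl) (simp only: inv_into_f_f[OF inj])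
      finally have "(\<Sum>x\<in>?X. fun_scale (c (?g x)) x) = 0" using s by simp
      moreover have "u i \<in> ?X" using bij i by (meson bij_betwE)
      ultimately have "c (?g (u i)) = 0"
        using fun_vs.independentD[OF ind fin subset_refl, of "\<lambda>x. c (?g x)"] by blast
      then show ?thesis by (simp only: inv_into_f_f[OF inj i])
    qed
    with * ** show "coord_basis m u" unfolding coord_basis_def by blast
    show "u ` {1..r1} \<subseteq> W" using blocks'(1) sub by blast
    have "u i \<in> B \<union> R" if "i \<in> {l + 1..m}" for i
      using blocks'(3,4)[of i] that by (cases "i \<le> l + r2") auto
    then show "u ` {l + 1..m} \<subseteq> V" using sub by blast
    show "\<forall>v\<in>V. \<exists>c. (\<forall>i. i \<notin> {l + 1..m} \<longrightarrow> c i = 0) \<and> v = (\<Sum>i=1..m. fun_scale (c i) (u i))"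
    proof
      fix v assume "v \<in> V"
      then have "v \<in> fun_vs.span (B \<union> R)" using sub by blast
      then obtain c where c: "v = (\<Sum>i=1..m. fun_scale (c i) (u i))"
        "\<And>i. i \<in> {1..m} \<Longrightarrow> u i \<notin> B \<union> R \<Longrightarrow> c i = 0" "\<And>i. i \<notin> {1..m} \<Longrightarrow> c i = 0"
        by (rule fun_vs.span_indexed[OF bij finite_atLeastAtMost, rotated]) auto
      have "c i = 0" if i: "i \<notin> {l + 1..m}" for i
      proof (cases "i \<in> {1..m}")
        case True
        then have "u i \<in> C \<union> D" using i blocks'(1,2)[of i] by (cases "i \<le> r1") auto
        then show ?thesis using c(2)[OF True] disj by blast
      qed (use c in auto)
      then show "\<exists>c. (\<forall>i. i \<notin> {l + 1..m} \<longrightarrow> c i = 0) \<and> v = (\<Sum>i=1..m. fun_scale (c i) (u i))"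
        using c(1) by blast
    qed
    show "\<forall>v\<in>W. \<exists>c. (\<forall>i. i \<notin> {1..r1} \<union> {l + 1..l + r2} \<longrightarrow> c i = 0) \<and>
      v = (\<Sum>i=1..m. fun_scale (c i) (u i))"
    proof
      fix v assume "v \<in> W"
      then have "v \<in> fun_vs.span (C \<union> B)" using sub by blast
      then obtain c where c: "v = (\<Sum>i=1..m. fun_scale (c i) (u i))"
        "\<And>i. i \<in> {1..m} \<Longrightarrow> u i \<notin> C \<union> B \<Longrightarrow> c i = 0" "\<And>i. i \<notin> {1..m} \<Longrightarrow> c i = 0"
        by (rule fun_vs.span_indexed[OF bij finite_atLeastAtMost, rotated]) auto
      have "c i = 0" if i: "i \<notin> {1..r1} \<union> {l + 1..l + r2}" for i
      proof (cases "i \<in> {1..m}")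
        case True
        then have "u i \<in> D \<union> R" using i blocks'(2,4)[of i] by (cases "i \<le> l") auto
        then show ?thesis using c(2)[OF True] disj by blast
      qed (use c in auto)
      then show "\<exists>c. (\<forall>i. i \<notin> {1..r1} \<union> {l + 1..l + r2} \<longrightarrow> c i = 0) \<and>
        v = (\<Sum>i=1..m. fun_scale (c i) (u i))"
        using c(1) by blast
    qed
  qed
qed

lemma dual_basis:
  fixes u :: "nat \<Rightarrow> nat \<Rightarrow> 'k::field"
  assumes u: "coord_basis m u"
  obtains q' where "right_inverse_on m (\<lambda>i j. u j i) q'"
    and "\<forall>c. \<forall>i\<in>{1..m}. (\<Sum>j=1..m. q' i j * (\<Sum>t=1..m. c t * u t j)) = c i"
proof -
  have "\<exists>c. j \<in> {1..m} \<longrightarrow> (\<lambda>i. if i = j then 1 else 0) = (\<Sum>i=1..m. fun_scale (c i) (u i))" for j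
    using u by (cases "j \<in> {1..m}") (auto simp: coord_basis_def coord_space_def)
  \<comment> \<open>\<open>d j\<close> holds the coordinates of the j-th standard vector in the
    basis \<open>u\<close>; transposed, it inverts the matrix with columns
    \<open>u i\<close>.\<close>
  then obtain d where d: "\<And>j. j \<in> {1..m} \<Longrightarrow> (\<lambda>i. if i = j then 1 else 0) = (\<Sum>i=1..m. fun_scale (d j i) (u i))"
    by metis
  have q: "(\<Sum>t=1..m. u t i * d j t) = (if i = j then 1 else 0)" if "j \<in> {1..m}" for i j
    using fun_cong[OF d[OF that], of i] unfolding sum_fun_scale_apply by (simp add: mult.commute)
  show thesis
  proof (rule that[of "\<lambda>t j. d j t"])
    have "(\<Sum>j=1..m. d j i * (\<Sum>t=1..m. c t * u t j)) = c i" if i: "i \<in> {1..m}" for c i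
    proof -
    define v where "v = (\<lambda>j. \<Sum>t=1..m. c t * u t j)"
    have v0: "v s = 0" if "s \<notin> {1..m}" for s unfolding v_def using that u by (intro sum.neutral) (auto simp: coord_basis_def coord_space_def)
    define g where "g i = (\<Sum>j=1..m. d j i * v j)" for i
    \<comment> \<open>\<open>g\<close> and \<open>c\<close> are both coordinates of
      \<open>v\<close>, so independence identifies them.\<close>
    have "(\<Sum>i=1..m. fun_scale (g i - c i) (u i)) = 0"
    proof (rule ext)
      fix s
      have "(\<Sum>i=1..m. g i * u i s) = (\<Sum>i=1..m. \<Sum>j=1..m. v j * (u i s * d j i))"
        unfolding g_def by (simp add: sum_distrib_left ac_simps)
      also have "\<dots> = (\<Sum>j=1..m. v j * (\<Sum>i=1..m. u i s * d j i))"
        by (subst sum.swap) (simp add: sum_distrib_left)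
      also have "\<dots> = (\<Sum>j=1..m. if s = j then v j else 0)"
        by (intro sum.cong refl) (simp add: q del: One_nat_def)
      also have "\<dots> = v s" using v0 by auto
      finally show "(\<Sum>i=1..m. fun_scale (g i - c i) (u i)) s = 0 s"
        unfolding sum_fun_scale_apply by (simp add: left_diff_distrib sum_subtractf v_def)
    qed
    then have "g i - c i = 0"
      using u i unfolding coord_basis_def by (elim conjE) (drule spec[of _ "\<lambda>i. g i - c i"], blast)
    then show ?thesis
      unfolding g_def v_def by simp
    qed
    then show "\<forall>c. \<forall>i\<in>{1..m}. (\<Sum>j=1..m. d j i * (\<Sum>t=1..m. c t * u t j)) = c i" by blast
  qed (use q in \<open>simp del: One_nat_def add: right_inverse_on_def\<close>)
qed

section \<open>Normal forms\<close>

text \<open>Off-diagonal terms come in equal pairs, and each pair is a multiple of 2.\<close>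

lemma sum_alternating_eq_0:
  fixes g :: "'i \<Rightarrow> 'i \<Rightarrow> 'k::comm_ring_1"
  assumes "finite A" "(2::'k) = 0"
    and "\<And>i j. i \<in> A \<Longrightarrow> j \<in> A \<Longrightarrow> g i j = g j i" "\<And>i. i \<in> A \<Longrightarrow> g i i = 0"
  shows "(\<Sum>i\<in>A. \<Sum>j\<in>A. g i j) = 0"
  using assms(1,3,4)
proof (induction A rule: finite_induct)
  case (insert x A)
  have "(\<Sum>i\<in>insert x A. \<Sum>j\<in>insert x A. g i j) =
    g x x + (\<Sum>j\<in>A. g x j) + (\<Sum>i\<in>A. g i x) + (\<Sum>i\<in>A. \<Sum>j\<in>A. g i j)"
    using insert.hyps by (simp add: sum.distrib)
  also have "(\<Sum>i\<in>A. g i x) = (\<Sum>i\<in>A. g x i)" using insert.prems by (intro sum.cong) auto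
  also have "(\<Sum>i\<in>A. \<Sum>j\<in>A. g i j) = 0" using insert by blast
  also have "g x x + (\<Sum>j\<in>A. g x j) + (\<Sum>j\<in>A. g x j) + 0 = g x x + 2 * (\<Sum>j\<in>A. g x j)" by simp
  finally show ?case using insert.prems assms(2) by simp
qed simp

text \<open>\<open>S\<close> is the inverse of the matrix of \<open>T\<close>, which exists because
  the last hypothesis makes the kernel trivial. Inversion preserves symmetry, and for p = 2 also the
  zero diagonal.\<close>

lemma symmetric_pairing_inverse:
  fixes T :: "nat \<Rightarrow> nat \<Rightarrow> 'k::field"
  assumes char2: "p = 2 \<Longrightarrow> (2::'k) = 0"
    and sym: "\<And>i j. i \<in> {1..n} \<Longrightarrow> j \<in> {1..n} \<Longrightarrow> T i j = T j i"
    and alt: "\<And>i. p = 2 \<Longrightarrow> i \<in> {1..n} \<Longrightarrow> T i i = 0"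
    and nonsing: "\<And>z i. (\<And>i. i \<in> {1..n} \<Longrightarrow> (\<Sum>j=1..n. T i j * z j) = 0) \<Longrightarrow> i \<in> {1..n} \<Longrightarrow> z i = 0"
  obtains S where "S \<in> GLss p n"
    and "\<And>a b. (\<And>i. i \<in> {1..n} \<Longrightarrow> a i = (\<Sum>j=1..n. T i j * b j)) \<Longrightarrow>
      mat 1 n (\<lambda>(_, j). b (j + 1)) = mat 1 n (\<lambda>(_, j). a (j + 1)) * S"
proof -
  define M where "M = mat n n (\<lambda>(i, j). T (i + 1) (j + 1))"
  have M: "M \<in> carrier_mat n n" by (simp add: M_def)
  have shift: "(\<Sum>j=1..n. f j) = (\<Sum>j<n. f (j + 1))" for f :: "nat \<Rightarrow> 'k"
    by (rule sum.reindex_bij_witness[of _ Suc "\<lambda>j. j - 1"]) auto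
  have "det M \<noteq> 0"
  proof
    assume "det M = 0"
    then obtain v where v: "v \<in> carrier_vec n" "v \<noteq> 0\<^sub>v n" "M *\<^sub>v v = 0\<^sub>v n"
      using det_0_iff_vec_prod_zero[OF M] by auto
    have "v $ i = 0" if i: "i < n" for i
    proof -
      have "(\<Sum>j=1..n. T k j * v $ (j - 1)) = 0" if k: "k \<in> {1..n}" for k
      proof -
        have "(M *\<^sub>v v) $ (k - 1) = (\<Sum>j<n. T k (j + 1) * v $ j)"
          using k v(1) by (auto simp: M_def scalar_prod_def atLeast0LessThan intro!: sum.cong)
        then show ?thesis unfolding shift using v(3) k by auto
      qed
      from nonsing[OF this, of "i + 1"] i show ?thesis by auto
    qed
    then have "v = 0\<^sub>v n" using v(1) by (intro eq_vecI) auto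
    then show False using v(2) by simp
  qed
  from det_non_zero_imp_unit[OF M this, of "()"] obtain S where S: "S \<in> carrier_mat n n" "S * M = 1\<^sub>m n" "M * S = 1\<^sub>m n"
    unfolding Units_def ring_mat_def by auto
  have MT: "transpose_mat M = M" using sym by (intro eq_matI) (auto simp: M_def)
  have "transpose_mat S * M = transpose_mat (M * S)"
    unfolding transpose_mult[OF M S(1)] MT ..
  then have "transpose_mat S * M = 1\<^sub>m n" unfolding S by simp
  then have "S = transpose_mat S * M * S" using S by simp
  also have "\<dots> = transpose_mat S * (M * S)" using S M by (intro assoc_mult_mat) auto
  also have "\<dots> = transpose_mat S" using S(1) unfolding S(3) by simp
  finally have ST: "transpose_mat S = S" ..
  have Ssym: "S $$ (i, j) = S $$ (j, i)" if "i < n" "j < n" for i j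
    using arg_cong[OF ST, of "\<lambda>A. A $$ (i, j)"] S(1) that by auto
  have "S $$ (i, i) = 0" if p: "p = 2" and i: "i < n" for i
  proof -
    \<comment> \<open>As S is symmetric, S = SMS exhibits \<open>S $$ (i, i)\<close> as the value of
      the alternating form M on a row of S.\<close>
    have "S = S * (M * S)" using S by simp
    then have "S $$ (i, i) = (S * (M * S)) $$ (i, i)" by simp
    also have "\<dots> = (\<Sum>j<n. \<Sum>k<n. S $$ (i, j) * M $$ (j, k) * S $$ (k, i))"
      using S(1) M i by (auto simp: scalar_prod_def atLeast0LessThan sum_distrib_left mult.assoc intro!: sum.cong)
    also have "\<dots> = 0"
    proof (rule sum_alternating_eq_0)
      show "(2::'k) = 0" using char2 p .
      fix j k assume jk: "j \<in> {..<n}" "k \<in> {..<n}"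
      have "M $$ (j, k) = M $$ (k, j)" using sym jk by (simp add: M_def)
      then show "S $$ (i, j) * M $$ (j, k) * S $$ (k, i) = S $$ (i, k) * M $$ (k, j) * S $$ (j, i)"
        using Ssym[of i] i jk by simp
    next
      fix j assume "j \<in> {..<n}"
      then show "S $$ (i, j) * M $$ (j, j) * S $$ (j, i) = 0" using alt[OF p, of "j + 1"] by (simp add: M_def)
    qed simp
    finally show ?thesis .
  qed
  then have "S \<in> GLss p n"
    using GL_I[OF S(1) M S(2)] ST by (simp add: GLss_def)
  moreover have "mat 1 n (\<lambda>(_, j). b (j + 1)) = mat 1 n (\<lambda>(_, j). a (j + 1)) * S" (is "?b = ?a * S")
    if ab: "\<And>i. i \<in> {1..n} \<Longrightarrow> a i = (\<Sum>j=1..n. T i j * b j)" for a b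
  proof -
    have b: "?b \<in> carrier_mat 1 n" by simp
    \<comment> \<open>By symmetry of \<open>T\<close>, the column relation a = Tb becomes a = bM for
      rows; multiplying by S recovers b.\<close>
    have "?a = ?b * M"
    proof (rule eq_matI)
      fix i j assume "i < dim_row (?b * M)" "j < dim_col (?b * M)"
      then have ij: "i = 0" "j < n" using M by auto
      have "a (j + 1) = (\<Sum>k<n. T (j + 1) (k + 1) * b (k + 1))"
        using ab[of "j + 1"] ij unfolding shift by simp
      also have "\<dots> = (\<Sum>k<n. b (k + 1) * T (k + 1) (j + 1))"
        using ij sym by (intro sum.cong) auto
      finally show "?a $$ (i, j) = (?b * M) $$ (i, j)"
        using ij by (simp add: M_def scalar_prod_def atLeast0LessThan)
    qed (auto simp: M_def)
    then have "?a * S = ?b * (M * S)" using assoc_mult_mat[OF b M S(1)] by simp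
    then show ?thesis unfolding S(3) using right_mult_one_mat[OF b] by simp
  qed
  ultimately show thesis by (rule that)
qed

lemma conj_params_normal_form:
  fixes a :: "nat \<Rightarrow> nat \<Rightarrow> 'k::field"
  assumes char2: "p = 2 \<Longrightarrow> (2::'k) = 0"
    and sym: "\<And>j l. j \<in> {1..r} \<Longrightarrow> l \<in> {1..r} \<Longrightarrow> heis_form m (a j) (a l) = heis_form m (a l) (a j)"
    and alt: "\<And>j. p = 2 \<Longrightarrow> j \<in> {1..r} \<Longrightarrow> heis_form m (a j) (a j) = 0"
  obtains q q' where
    "right_inverse_on m q q'"
    "in_listed_set p m r (\<lambda>j\<in>{1..r}. eta m (conj_params m q q' (a j)) - 1\<^sub>m (m + 2))"
proof -
  \<comment> \<open>\<open>b j\<close> is the column \<beta> of the j-th matrix, extended by zero to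
    lie in \<open>coord_space m\<close>; \<open>pr j\<close> is its row \<alpha> as a
    functional.\<close>
  define b where "b j i = (if i \<in> {1..m} then a j (m + i) else 0)" for j i
  define pr where "pr j v = (\<Sum>s=1..m. a j s * v s)" for j and v :: "nat \<Rightarrow> 'k"
  have pr_b: "pr j (b l) = heis_form m (a j) (a l)" for j l
    unfolding pr_def heis_form_def b_def by (intro sum.cong) auto
  have pr_sum: "pr j (\<Sum>i\<in>I. fun_scale (c i) (v i)) = (\<Sum>i\<in>I. c i * pr j (v i))" for j I c and v :: "nat \<Rightarrow> nat \<Rightarrow> 'k"
    unfolding pr_def sum_fun_scale_apply sum_distrib_left
    by (subst sum.swap) (simp add: ac_simps)
  define V where "V = {v \<in> coord_space m. (\<forall>j\<in>{1..r}. pr j v = 0)}"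
  define W where "W = range (\<lambda>y. \<Sum>j=1..r. fun_scale (y j) (b j))"
  have V: "fun_vs.subspace V"
  proof (rule fun_vs.subspaceI)
    show "0 \<in> V" by (simp add: V_def pr_def coord_space_def)
    show "x + y \<in> V" if "x \<in> V" "y \<in> V" for x y
      using that by (simp add: V_def pr_def coord_space_def distrib_left sum.distrib)
    show "fun_scale c x \<in> V" if "x \<in> V" for c x
    proof -
      have "pr j (fun_scale c x) = c * pr j x" for j
        by (simp add: pr_def fun_scale_def sum_distrib_left ac_simps)
      then show ?thesis using that by (simp add: V_def coord_space_def) (simp add: fun_scale_def)
    qed
  qed
  have W: "fun_vs.subspace W"
  proof (rule fun_vs.subspaceI)
    show "0 \<in> W" unfolding W_def by (rule range_eqI[of _ _ "\<lambda>_. 0"]) simp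
    show "x + y \<in> W" if xy: "x \<in> W" "y \<in> W" for x y
    proof -
      obtain c d where "x = (\<Sum>j=1..r. fun_scale (c j) (b j))" "y = (\<Sum>j=1..r. fun_scale (d j) (b j))"
        using xy unfolding W_def by blast
      then have "x + y = (\<Sum>j=1..r. fun_scale (c j + d j) (b j))"
        by (simp add: fun_vs.scale_left_distrib sum.distrib)
      then show ?thesis by (auto simp: W_def)
    qed
    show "fun_scale c x \<in> W" if x: "x \<in> W" for c x
    proof -
      obtain d where "x = (\<Sum>j=1..r. fun_scale (d j) (b j))" using x unfolding W_def by blast
      then have "fun_scale c x = (\<Sum>j=1..r. fun_scale (c * d j) (b j))"
        by (simp add: fun_vs.scale_sum_right)
      then show ?thesis by (auto simp: W_def)
    qed
  qed
  have V0: "V \<subseteq> coord_space m" by (auto simp: V_def)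
  have W0: "W \<subseteq> coord_space m"
    unfolding W_def coord_space_def sum_fun_scale_apply image_subset_iff mem_Collect_eq
    by (auto simp: b_def intro!: sum.neutral)
  obtain u l r1 r2 where le: "r1 \<le> l" "l + r2 \<le> m"
    and basis: "coord_basis m u"
    and uW: "u ` {1..r1} \<subseteq> W" and uV: "u ` {l + 1..m} \<subseteq> V"
    and repV: "\<forall>v\<in>V. \<exists>c. (\<forall>i. i \<notin> {l + 1..m} \<longrightarrow> c i = 0) \<and> v = (\<Sum>i=1..m. fun_scale (c i) (u i))"
    and repW: "\<forall>v\<in>W. \<exists>c. (\<forall>i. i \<notin> {1..r1} \<union> {l + 1..l + r2} \<longrightarrow> c i = 0) \<and>
      v = (\<Sum>i=1..m. fun_scale (c i) (u i))"
    by (rule adapted_basis[OF V V0 W W0])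
  obtain q' where inv: "right_inverse_on m (\<lambda>i j. u j i) q'"
    and coord: "\<forall>c. \<forall>i\<in>{1..m}. (\<Sum>j=1..m. q' i j * (\<Sum>t=1..m. c t * u t j)) = c i"
    by (rule dual_basis[OF basis])
  let ?q = "\<lambda>i j. u j i"
  define a' where "a' j = conj_params m ?q q' (a j)" for j
  \<comment> \<open>New row entries are values of the row functional on the basis, hence vanish on
    basis vectors in V. New column entries are coordinates of \<open>b j\<close>, hence vanish where
    W has none.\<close>
  have a'_fst: "a' j i = pr j (u i)" if "i \<in> {1..m}" for i j
    using that by (simp add: a'_def conj_params_def pr_def)
  have a'_fst0: "a' j i = 0" if "i \<in> {l + 1..m}" "j \<in> {1..r}" for i j
    using uV that a'_fst[of i j] by (auto simp: V_def image_subset_iff)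
  have a'_snd0: "a' j (m + i) = 0" if "i \<in> {1..m}" "i \<notin> {1..r1} \<union> {l + 1..l + r2}" "j \<in> {1..r}" for i j
  proof -
    have "b j = (\<Sum>k=1..r. fun_scale (if k = j then 1 else 0) (b k))"
      using that(3) by (auto simp: fun_eq_iff sum_fun_scale_apply if_distrib[where f = "\<lambda>y. y * _"] cong: if_cong)
    then have "b j \<in> W" unfolding W_def by (rule range_eqI[of _ _ "\<lambda>k. if k = j then 1 else 0"])
    then obtain c where c: "\<forall>i. i \<notin> {1..r1} \<union> {l + 1..l + r2} \<longrightarrow> c i = 0" "b j = (\<Sum>i=1..m. fun_scale (c i) (u i))"
      using repW by blast
    have "a' j (m + i) = (\<Sum>s=1..m. q' i s * b j s)"
      using that(1) by (auto simp: a'_def conj_params_def b_def intro!: sum.cong)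
    also have "\<dots> = c i" unfolding c(2) sum_fun_scale_apply using coord that(1) by blast
    finally show ?thesis using c(1) that(2) by simp
  qed
  \<comment> \<open>Positions r1+1..l carry no column entries and positions beyond l no row entries,
    so only the first r1 contribute.\<close>
  have form: "heis_form m (a j) (a k) = (\<Sum>t=1..r1. a' j t * a' k (m + t))"
    if "j \<in> {1..r}" "k \<in> {1..r}" for j k
  proof -
    have "heis_form m (a j) (a k) = heis_form m (a' j) (a' k)"
      unfolding a'_def by (rule heis_form_conj_params[OF inv, symmetric])
    also have "\<dots> = (\<Sum>t=1..m. a' j t * a' k (m + t))" by (simp add: heis_form_def)
    also have "\<dots> = (\<Sum>t=1..r1. a' j t * a' k (m + t))"
    proof (rule sum.mono_neutral_right)
      show "\<forall>t\<in>{1..m} - {1..r1}. a' j t * a' k (m + t) = 0"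
      proof
        fix t assume t: "t \<in> {1..m} - {1..r1}"
        show "a' j t * a' k (m + t) = 0"
        proof (cases "t \<le> l")
          case True
          then show ?thesis using a'_snd0[of t k] t that by auto
        next
          case False
          then show ?thesis using a'_fst0[of t j] t that by auto
        qed
      qed
    qed (use le in auto)
    finally show ?thesis .
  qed
  show thesis
  \<comment> \<open>\<open>r1 = 0\<close> says that W lies in V.\<close>
  proof (cases "r1 = 0")
    case True
    \<comment> \<open>The sets \<open>daleth_flat\<close> use the opposite order of the basis.\<close>
    have rev: "(\<Sum>t=1..m. f (m + 1 - t)) = (\<Sum>t=1..m. f t)" for f :: "nat \<Rightarrow> 'k"
      by (rule sum.reindex_bij_witness[of _ "\<lambda>t. m + 1 - t" "\<lambda>t. m + 1 - t"]) auto
    let ?p = "\<lambda>i j. u (m + 1 - j) i" and ?p' = "\<lambda>i j. q' (m + 1 - i) j"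
    show thesis
    proof (rule that)
      show "right_inverse_on m ?p ?p'"
        unfolding right_inverse_on_def
      proof (intro ballI)
        fix i j assume ij: "i \<in> {1..m}" "j \<in> {1..m}"
        show "(\<Sum>t=1..m. ?p i t * ?p' t j) = (if i = j then 1 else 0)"
          using right_inverse_onD[OF inv ij] rev[of "\<lambda>t. u t i * q' t j"] by simp
      qed
      have "eta m (conj_params m ?p ?p' (a j)) - 1\<^sub>m (m + 2) \<in> daleth_flat m" if j: "j \<in> {1..r}" for j
      proof -
        let ?c = "conj_params m ?p ?p' (a j)"
        \<comment> \<open>After the reversal, row entries occupy the last l positions and column
          entries lie among the first m - l. Together they fit into the window of length m starting
          at m + 1 - l.\<close>
        have "?c i = 0" if i: "i \<in> {1..2 * m + 1}" "i \<notin> {m + 1 - l..m + (m + 1 - l) - 1} \<union> {2 * m + 1}" for i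
        proof -
          consider "i < m + 1 - l" | "i \<in> {m + 1..2 * m}" "m + (m + 1 - l) \<le> i" using i le by force
          then show ?thesis
          proof cases
            case 1
            then have "i \<in> {1..m}" "m + 1 - i \<in> {1..m}" using i by auto
            then have "?c i = a' j (m + 1 - i)" unfolding a'_def conj_params_def by (simp only: if_True)
            moreover have "m + 1 - i \<in> {l + 1..m}" using 1 i by auto
            ultimately show ?thesis using a'_fst0 j by simp
          next
            case 2
            then have "i \<notin> {1..m}" "m + (m + 1 - (i - m)) \<in> {m + 1..2 * m}" "m + (m + 1 - (i - m)) \<notin> {1..m}"
              by auto
            then have "?c i = a' j (m + (m + 1 - (i - m)))"
              using 2(1) unfolding a'_def conj_params_def by (simp only: if_True if_False add_diff_cancel_left')
            moreover have "m + 1 - (i - m) \<in> {1..m}" "m + 1 - (i - m) \<notin> {1..r1} \<union> {l + 1..l + r2}"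
              using 2 True le by auto
            ultimately show ?thesis using a'_snd0 j by simp
          qed
        qed
        moreover have "m + 1 - l \<in> {1..m + 1}" using le by auto
        ultimately show ?thesis unfolding daleth_flat_def by blast
      qed
      then show "in_listed_set p m r (\<lambda>j\<in>{1..r}. eta m (conj_params m ?p ?p' (a j)) - 1\<^sub>m (m + 2))"
        unfolding in_listed_set_def tuples_def by (intro disjI1 restrict_PiE_iff[THEN iffD2] ballI)
    qed
  next
    case False
    have "\<exists>y. i \<in> {1..r1} \<longrightarrow> u i = (\<Sum>j=1..r. fun_scale (y j) (b j))" for i
      using uW unfolding W_def by blast
    then obtain Y where Y: "\<And>i. i \<in> {1..r1} \<Longrightarrow> u i = (\<Sum>j=1..r. fun_scale (Y i j) (b j))" by metis
    \<comment> \<open>The pairing of \<open>u i\<close> with \<open>u t\<close>. Expanding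
      \<open>u t\<close> as well gives YHY^T, with H the matrix of form values; symmetry and, for p
      = 2, the zero diagonal are inherited from H.\<close>
    define T where "T i t = (\<Sum>j=1..r. Y i j * a' j t)" for i t
    have T_form: "T i t = (\<Sum>j=1..r. \<Sum>k=1..r. Y i j * heis_form m (a j) (a k) * Y t k)"
      if "t \<in> {1..r1}" for i t
    proof -
      have "a' j t = (\<Sum>k=1..r. Y t k * heis_form m (a j) (a k))" for j
        using that le a'_fst[of t j] by (simp add: Y pr_sum pr_b)
      then show ?thesis by (simp add: T_def sum_distrib_left ac_simps)
    qed
    \<comment> \<open>Swapping the arguments of the form moves \<open>a' j\<close> from the row side
      to the column side, so its row entries become \<open>T\<close> applied to its column
      entries.\<close>
    have a'_T: "a' j i = (\<Sum>t=1..r1. T i t * a' j (m + t))" if i: "i \<in> {1..r1}" and j: "j \<in> {1..r}" for i j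
    proof -
      have "a' j i = (\<Sum>k=1..r. Y i k * heis_form m (a j) (a k))"
        using i le a'_fst[of i j] by (simp add: Y pr_sum pr_b)
      also have "\<dots> = (\<Sum>k=1..r. Y i k * (\<Sum>t=1..r1. a' k t * a' j (m + t)))"
        using j sym form by (intro sum.cong) auto
      also have "\<dots> = (\<Sum>t=1..r1. T i t * a' j (m + t))"
        unfolding T_def sum_distrib_left sum_distrib_right by (subst sum.swap) (simp add: ac_simps)
      finally show ?thesis .
    qed
    obtain S where S: "S \<in> GLss p r1"
      and row: "\<And>a b. (\<And>i. i \<in> {1..r1} \<Longrightarrow> a i = (\<Sum>j=1..r1. T i j * b j)) \<Longrightarrow>
        mat 1 r1 (\<lambda>(_, j). b (j + 1)) = mat 1 r1 (\<lambda>(_, j). a (j + 1)) * S"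
    proof (rule symmetric_pairing_inverse[of p r1 T])
      show Tsym: "T i t = T t i" if "i \<in> {1..r1}" "t \<in> {1..r1}" for i t
      proof -
        have "T i t = (\<Sum>k=1..r. \<Sum>j=1..r. Y i j * heis_form m (a j) (a k) * Y t k)"
          unfolding T_form[OF that(2)] by (rule sum.swap)
        also have "\<dots> = T t i"
          unfolding T_form[OF that(1)] using sym by (intro sum.cong) (auto simp: ac_simps)
        finally show ?thesis .
      qed
      show "T i i = 0" if "p = 2" "i \<in> {1..r1}" for i
        unfolding T_form[OF that(2)]
        by (rule sum_alternating_eq_0) (use char2 that sym alt in \<open>auto simp: ac_simps\<close>)
      show "z i = 0" if z: "\<And>i. i \<in> {1..r1} \<Longrightarrow> (\<Sum>j=1..r1. T i j * z j) = 0" and i: "i \<in> {1..r1}" for z i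
      proof -
        \<comment> \<open>A kernel vector \<open>z\<close> of \<open>T\<close> yields a combination
          \<open>v\<close> of the first r1 basis vectors that every row kills. So \<open>v\<close>
          lies in V, which involves only basis vectors after l, and independence forces
          \<open>z\<close> to vanish.\<close>
        define z' where "z' k = (if k \<in> {1..r1} then z k else 0)" for k
        define v where "v = (\<Sum>k=1..m. fun_scale (z' k) (u k))"
        have "pr j v = 0" if j: "j \<in> {1..r}" for j
        proof -
          have "pr j v = (\<Sum>k=1..m. z' k * a' j k)"
            unfolding v_def pr_sum by (intro sum.cong) (auto simp: a'_fst)
          also have "\<dots> = (\<Sum>k=1..r1. z k * a' j k)"
            by (rule sum.mono_neutral_cong_right) (use le in \<open>auto simp: z'_def\<close>)
          also have "\<dots> = (\<Sum>k=1..r1. \<Sum>t=1..r1. z k * T k t * a' j (m + t))"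
            using a'_T j by (intro sum.cong) (auto simp: sum_distrib_left ac_simps)
          also have "\<dots> = (\<Sum>t=1..r1. \<Sum>k=1..r1. z k * T k t * a' j (m + t))"
            by (rule sum.swap)
          also have "\<dots> = (\<Sum>t=1..r1. (\<Sum>k=1..r1. T t k * z k) * a' j (m + t))"
            unfolding sum_distrib_right by (intro sum.cong refl) (metis Tsym mult.commute)
          also have "\<dots> = 0" using z by (intro sum.neutral) auto
          finally show ?thesis .
        qed
        moreover have "v \<in> coord_space m"
          using basis unfolding v_def coord_basis_def coord_space_def sum_fun_scale_apply
          by (auto intro!: sum.neutral)
        ultimately have "v \<in> V" by (simp add: V_def)
        then obtain c where c: "\<forall>i. i \<notin> {l + 1..m} \<longrightarrow> c i = 0" "v = (\<Sum>i=1..m. fun_scale (c i) (u i))"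
          using repV by blast
        have "(\<Sum>k=1..m. fun_scale (z' k - c k) (u k)) = v - v"
          unfolding fun_vs.scale_left_diff_distrib sum_subtractf v_def[symmetric] c(2)[symmetric] ..
        then have "z' i - c i = 0"
          using basis i le unfolding coord_basis_def
          by (elim conjE) (drule spec[of _ "\<lambda>k. z' k - c k"], auto)
        then show ?thesis using c(1) i le by (auto simp: z'_def)
      qed
    qed (use char2 in blast)+
    have "eta m (conj_params m ?q q' (a j)) - 1\<^sub>m (m + 2) \<in> frak_h m l r1 r2 S" if j: "j \<in> {1..r}" for j
    proof -
      have "a' j i = 0" if "l + 1 \<le> i \<and> i \<le> m \<or> m + r1 + 1 \<le> i \<and> i \<le> m + l \<or>
        m + l + r2 + 1 \<le> i \<and> i \<le> 2 * m" for i
        using that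
      proof (elim disjE)
        assume "l + 1 \<le> i \<and> i \<le> m"
        then show ?thesis using a'_fst0[of i j] j by auto
      next
        assume "m + r1 + 1 \<le> i \<and> i \<le> m + l"
        then have "i - m \<in> {1..m}" "i - m \<notin> {1..r1} \<union> {l + 1..l + r2}" "m + (i - m) = i"
          using le by auto
        then show ?thesis using a'_snd0[of "i - m" j] j by simp
      next
        assume "m + l + r2 + 1 \<le> i \<and> i \<le> 2 * m"
        then have "i - m \<in> {1..m}" "i - m \<notin> {1..r1} \<union> {l + 1..l + r2}" "m + (i - m) = i"
          using le by auto
        then show ?thesis using a'_snd0[of "i - m" j] j by simp
      qed
      moreover have "mat 1 r1 (\<lambda>(_, k). a' j (m + (k + 1))) = mat 1 r1 (\<lambda>(_, k). a' j (k + 1)) * S"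
        by (rule row[of "a' j" "\<lambda>k. a' j (m + k)"]) (rule a'_T[OF _ j])
      ultimately show ?thesis unfolding frak_h_def a'_def[symmetric] by blast
    qed
    then have "(\<lambda>j\<in>{1..r}. eta m (conj_params m ?q q' (a j)) - 1\<^sub>m (m + 2)) \<in> tuples r (frak_h m l r1 r2 S)"
      unfolding tuples_def by (intro restrict_PiE_iff[THEN iffD2] ballI)
    moreover have "(l, r1, r2) \<in> Omega m" using le False by (auto simp: Omega_def)
    ultimately have "in_listed_set p m r (\<lambda>j\<in>{1..r}. eta m (conj_params m ?q q' (a j)) - 1\<^sub>m (m + 2))"
      unfolding in_listed_set_def using S by blast
    with inv show thesis by (rule that)
  qed
qed

section \<open>Both assertions combined\<close>

theorem theorem5p7:
  fixes p r m :: nat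
  assumes "CHAR('k::field) = p" and "p > 0" and "r \<ge> 1" and "m \<ge> 1"
  shows
    "(\<forall>N :: nat \<Rightarrow> 'k mat.
        N \<in> commuting_nilpotents p (m + 2) r \<and> in_listed_set p m r N \<longrightarrow>
        (\<exists>\<rho> \<in> hom (ZpZ_pow p r) (GL (m + 2)).
           (\<forall>i. \<rho> (residue_tuple p r i) = power_product (m + 2) r N i) \<and>
           \<rho> ` carrier (ZpZ_pow p r) \<subseteq> Heisenberg m))
     \<and>
     (\<forall>\<rho> :: (nat \<Rightarrow> int) \<Rightarrow> 'k mat.
        \<rho> \<in> hom (ZpZ_pow p r) (GL (m + 2)) \<and>
        \<rho> ` carrier (ZpZ_pow p r) \<subseteq> Heisenberg m \<longrightarrow>
        (let N = (\<lambda>i\<in>{1..r}. \<rho> (std_gen p r i) - 1\<^sub>m (m + 2)) in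
           N \<in> commuting_nilpotents p (m + 2) r \<and>
           (\<exists>N' \<in> commuting_nilpotents p (m + 2) r.
              equivalent_tuples (m + 2) r N N' \<and> in_listed_set p m r N')))"
proof -
  have prime: "prime p" using prime_CHAR_semidom[where 'a = 'k] assms by simp
  have char2: "(2::'k) = 0" if "p = 2" using assms(1) that by (metis of_nat_CHAR of_nat_numeral)
  have part2: "let N = (\<lambda>i\<in>{1..r}. \<rho> (std_gen p r i) - 1\<^sub>m (m + 2)) in
     N \<in> commuting_nilpotents p (m + 2) r \<and>
     (\<exists>N' \<in> commuting_nilpotents p (m + 2) r. equivalent_tuples (m + 2) r N N' \<and> in_listed_set p m r N')"
    if \<rho>: "\<rho> \<in> hom (ZpZ_pow p r) (GL (m + 2))" "\<rho> ` carrier (ZpZ_pow p r) \<subseteq> Heisenberg m"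
    for \<rho> :: "(nat \<Rightarrow> int) \<Rightarrow> 'k mat"
  proof -
    obtain a where a: "\<And>j. j \<in> {1..r} \<Longrightarrow> \<rho> (std_gen p r j) = eta m (a j)"
      and sym: "\<And>j l. j \<in> {1..r} \<Longrightarrow> l \<in> {1..r} \<Longrightarrow> heis_form m (a j) (a l) = heis_form m (a l) (a j)"
      and alt: "\<And>j. p = 2 \<Longrightarrow> j \<in> {1..r} \<Longrightarrow> heis_form m (a j) (a j) = 0"
      by (rule representation_eta_params[OF assms(1) prime \<rho>]) (rule that; blast)
    obtain q q' where
      inv: "right_inverse_on m q q'"
      and listed: "in_listed_set p m r (\<lambda>j\<in>{1..r}. eta m (conj_params m q q' (a j)) - 1\<^sub>m (m + 2))"
      by (rule conj_params_normal_form[where p = p and r = r and a = a and m = m, OF char2 sym alt])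
        assumption+
    let ?N = "\<lambda>i\<in>{1..r}. \<rho> (std_gen p r i) - 1\<^sub>m (m + 2)"
    let ?N' = "\<lambda>j\<in>{1..r}. eta m (conj_params m q q' (a j)) - 1\<^sub>m (m + 2)"
    have N: "?N j = eta m (a j) - 1\<^sub>m (m + 2)" if "j \<in> {1..r}" for j
      using that by (simp only: restrict_apply a if_True)
    have N': "?N' j = eta m (conj_params m q q' (a j)) - 1\<^sub>m (m + 2)" if "j \<in> {1..r}" for j
      using that by (simp only: restrict_apply if_True)
    have "?N \<in> commuting_nilpotents p (m + 2) r"
      using sym alt by (subst commuting_nilpotents_eta_iff[OF prime restrict_extensional N]) blast+
    moreover have "?N' \<in> commuting_nilpotents p (m + 2) r"
      using sym alt
      by (subst commuting_nilpotents_eta_iff[OF prime restrict_extensional N'])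
        (simp_all only: heis_form_conj_params[OF inv], blast)
    moreover have "equivalent_tuples (m + 2) r ?N ?N'"
      by (rule equivalent_conj_params[OF inv N N'])
    ultimately show ?thesis unfolding Let_def using listed by blast
  qed
  show ?thesis
    using listed_tuple_hom[OF assms(1) prime] part2 by blast
qed

end
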